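(* Let $p\in[1,\infty)$, let $A\subset\mathbb R^N$ be an open set, and let $J_k,J\colon A^2\to[0,\infty]$, $k\in\mathbb N$, be measurable functions, where $A^2=A\times A$. The following hold. (i) Assume that, for every $\varepsilon>0$, there exists $\delta>0$ such that $$\inf_{k\in\mathbb N}J_k(x,y)\ge\frac1{\varepsilon\delta^N}\quad\text{for }\mathscr L^{2N}\text{-a.e. }(x,y)\in A^2\text{ such that }|x-y|<\delta.$$ If $(u_k)_{k\in\mathbb N}\subset L^p(A)$ is such that $\sup_{k\in\mathbb N}\big(\|u_k\|_{L^p(A)}+\mathscr J_{k,p}(u_k)\big)<\infty$, then $(u_k)_{k\in\mathbb N}$ is compact in $L^p(E)$ for every compact set $E\subset A$. (ii) Assume that $\liminf_{k\to\infty}J_k\ge J$ $\mathscr L^{2N}$-a.e. in $A^2$. If $(u_k)_{k\in\mathbb N}\subset L^p(A)$ is such that $u_k\to u$ in $L^p(A)$ as $k\to\infty$ for some $u\in L^p(A)$, then $\liminf_{k\to\infty}\mathscr J_{k,p}(u_k)\ge\mathscr J_p(u)$. (iii) Assume that $J=\lim_{k\to\infty}J_k$ $\mathscr L^{2N}$-a.e. on $A^2$ and that either (a) there exists $C>0$ such that $\sup_{k\in\mathbb N}J_k\le CJ$ $\mathscr L^{2N}$-a.e. on $A^2$, or (b) there exist $H_+,H_-\subset A^2$, with $\mathscr L^{2N}(H_+\cap H_-)=0$ and $\mathscr L^{2N}(A^2\setminus(H_+\cup H_-))=0$, such that, for all $k\in\mathbb N$, $J_k\le J_{k+1}$ a.e.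 on $H_+$ and $J_k\ge J_{k+1}$ a.e. on $H_-$. If $u\in L^p(A)$ is such that $\mathscr J_p(u)<\infty$, then $\lim_{k\to\infty}\mathscr J_{k,p}(u)=\mathscr J_p(u)$. Therefore, if $J=\lim_{k\to\infty}J_k$ $\mathscr L^{2N}$-a.e. on $A^2$ and either (a) or (b) holds, then, as $k\to\infty$, the functionals $(\mathscr J_{k,p})_{k\in\mathbb N}$ converge pointwise and in the sense of $\Gamma$-convergence to $\mathscr J_p$ with respect to the $L^p$ topology in $\mathcal W^{J,p}(A)$.
   Context: For $u\in L^p(A)$, $$\mathscr J_{k,p}(u)=\int_A\int_A|u(x)-u(y)|^p\,J_k(x,y)\,dx\,dy,\qquad\mathscr J_p(u)=\int_A\int_A|u(x)-u(y)|^p\,J(x,y)\,dx\,dy,$$ with values in $[0,\infty]$, and $\mathcal W^{J,p}(A)=\{u\in L^p(A):\mathscr J_p(u)<\infty\}$. A sequence is called compact in a Banach space if it is relatively compact (every subsequence has a convergent further subsequence). $\mathscr L^{2N}$ is Lebesgue measure on $\mathbb R^{2N}$.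
   Formalization: In (i) δ is required to satisfy δ ≤ 1 (without a bound, J_k = 1 on (0,1) is a counterexample); in case (b) it is added that 𝒥_{k,p}(u) < ∞ for some k, in the final claim for every u in W^{J,p}(A) (else J_k = 1/(k+1), J = 0 on ℝ is a counterexample). *)

theory Defs
  imports "HOL-Analysis.Analysis"
begin

(* Elements of L^p are represented by functions rather than by a.e.-classes, so Lp_norm is
   only a seminorm and limits in it are unique only a.e.  The notions are meant for
   1 \<le> p < \<infinity>; then 0 powr p = 0 agrees with |0|^p. *)

definition Lp :: "real \<Rightarrow> 'a measure \<Rightarrow> ('a \<Rightarrow> real) set" where
  "Lp p M = {u \<in> borel_measurable M. integrable M (\<lambda>x. \<bar>u x\<bar> powr p)}"

definition Lp_norm :: "real \<Rightarrow> 'a measure \<Rightarrow> ('a \<Rightarrow> real) \<Rightarrow> real" where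
  "Lp_norm p M u = (\<integral>x. \<bar>u x\<bar> powr p \<partial>M) powr (1 / p)"

definition Lp_dist :: "real \<Rightarrow> 'a measure \<Rightarrow> ('a \<Rightarrow> real) \<Rightarrow> ('a \<Rightarrow> real) \<Rightarrow> real" where
  "Lp_dist p M u v = Lp_norm p M (\<lambda>x. u x - v x)"

definition Lp_compact_seq :: "real \<Rightarrow> 'a measure \<Rightarrow> (nat \<Rightarrow> 'a \<Rightarrow> real) \<Rightarrow> bool" where
  "Lp_compact_seq p M u \<longleftrightarrow> (\<forall>k. u k \<in> Lp p M) \<and>
     (\<forall>r. strict_mono (r :: nat \<Rightarrow> nat) \<longrightarrow>
        (\<exists>s v. strict_mono (s :: nat \<Rightarrow> nat) \<and> v \<in> Lp p M \<and>
           (\<lambda>k. Lp_dist p M (u (r (s k))) v) \<longlonglongrightarrow> 0))"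

(* The double integral over A x A is taken with respect to 2N-dimensional Lebesgue measure.
   In ennreal, 0 * \<infinity> = 0, so points with u x = u y do not contribute even where the
   kernel is infinite. *)

definition energy ::
  "real \<Rightarrow> (real ^ 'n) set \<Rightarrow> ((real ^ 'n) \<times> (real ^ 'n) \<Rightarrow> ennreal) \<Rightarrow> (real ^ 'n \<Rightarrow> real) \<Rightarrow> ennreal"
  where
  "energy p A J u =
     (\<integral>\<^sup>+ (x, y). ennreal (\<bar>u x - u y\<bar> powr p) * J (x, y) \<partial>lebesgue_on (A \<times> A))"

definition energy_space ::
  "real \<Rightarrow> (real ^ 'n) set \<Rightarrow> ((real ^ 'n) \<times> (real ^ 'n) \<Rightarrow> ennreal) \<Rightarrow> (real ^ 'n \<Rightarrow> real) set"
  where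
  "energy_space p A J = {u \<in> Lp p (lebesgue_on A). energy p A J u < \<infinity>}"

definition dominated_kernels ::
  "(real ^ 'n) set \<Rightarrow> (nat \<Rightarrow> (real ^ 'n) \<times> (real ^ 'n) \<Rightarrow> ennreal) \<Rightarrow>
   ((real ^ 'n) \<times> (real ^ 'n) \<Rightarrow> ennreal) \<Rightarrow> bool" where
  "dominated_kernels A Jk J \<longleftrightarrow>
     (\<exists>C::real. C > 0 \<and> (AE z in lebesgue_on (A \<times> A). (SUP k. Jk k z) \<le> ennreal C * J z))"

(* null_sets rather than emeasure = 0, since emeasure vanishes on non-measurable sets. *)

definition piecewise_monotone_kernels ::
  "(real ^ 'n) set \<Rightarrow> (nat \<Rightarrow> (real ^ 'n) \<times> (real ^ 'n) \<Rightarrow> ennreal) \<Rightarrow> bool" where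
  "piecewise_monotone_kernels A Jk \<longleftrightarrow>
     (\<exists>Hp Hm. Hp \<subseteq> A \<times> A \<and> Hm \<subseteq> A \<times> A \<and>
        Hp \<inter> Hm \<in> null_sets lebesgue \<and>
        A \<times> A - (Hp \<union> Hm) \<in> null_sets lebesgue \<and>
        (\<forall>k. (AE z in lebesgue. z \<in> Hp \<longrightarrow> Jk k z \<le> Jk (Suc k) z) \<and>
             (AE z in lebesgue. z \<in> Hm \<longrightarrow> Jk (Suc k) z \<le> Jk k z)))"

(* Sequential Gamma-convergence on the set X with respect to the pseudometric d. *)

definition gamma_converges ::
  "'x set \<Rightarrow> ('x \<Rightarrow> 'x \<Rightarrow> real) \<Rightarrow> (nat \<Rightarrow> 'x \<Rightarrow> ennreal) \<Rightarrow> ('x \<Rightarrow> ennreal) \<Rightarrow> bool" where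
  "gamma_converges X d F G \<longleftrightarrow> (\<forall>x\<in>X.
     (\<forall>xs. (\<forall>k. xs k \<in> X) \<and> (\<lambda>k. d (xs k) x) \<longlonglongrightarrow> 0 \<longrightarrow> G x \<le> liminf (\<lambda>k. F k (xs k))) \<and>
     (\<exists>xs. (\<forall>k. xs k \<in> X) \<and> (\<lambda>k. d (xs k) x) \<longlonglongrightarrow> 0 \<and> limsup (\<lambda>k. F k (xs k)) \<le> G x))"

end

theory Submission
  imports Defs "HOL-Library.Diagonal_Subsequence"
begin

text \<open>
  The compactness statement rests on one inequality. Divide the space into half-open cubes
  whose points have mutual distances less than \<open>\<delta>\<close>. On a cube \<open>Q\<close> there is a constant \<open>c\<close>, namely a suitable value of \<open>u\<close>, such
  that the integral of \<open>\<bar>u - c\<bar> powr p\<close> over \<open>Q\<close> is at most the double integral of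
  \<open>\<bar>u x - u y\<bar> powr p\<close> over \<open>Q \<times> Q\<close>, divided by the volume of \<open>Q\<close> (\<open>ex_constant_approximation\<close>). This volume
  is comparable to \<open>\<delta> ^ N\<close>, \<open>N\<close> being the dimension, while the kernel is at least \<open>1 / (\<epsilon> * \<delta> ^ N)\<close>
  on \<open>Q \<times> Q\<close>. Summing over the cubes, a function of bounded energy is at distance of order
  \<open>\<epsilon> powr (1 / p)\<close> from a step function on a grid that does not depend on the function
  (\<open>step_approximation_by_energy\<close>). A sequence of bounded energy and bounded norm is therefore
  totally bounded on every compact \<open>E \<subseteq> A\<close>, and completeness of \<open>L\<^sup>p\<close> provides the limits
  (\<open>Lp_compact_seq_of_step_approximation\<close>). Shrinking \<open>\<delta>\<close> keeps the cubes that meet \<open>E\<close> inside \<open>A\<close>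
  (\<open>kernel_lower_bound_near_compact\<close>).

  The lower bound for the lower limit is Fatou's lemma along an almost everywhere convergent
  subsequence (\<open>energy_liminf\<close>). Convergence for fixed \<open>u\<close> is dominated convergence: piecewise monotone
  kernels are eventually dominated by the sum of their limit and of one kernel for which \<open>u\<close> has
  finite energy (\<open>energy_pointwise_convergence\<close>). Gamma-convergence combines the two, with constant
  recovery sequences.
\<close>

section \<open>Lebesgue measure on products\<close>

text \<open>
  Lebesgue measurable sets are Borel up to null sets, so a Borel map has to control the preimages
  of null sets before it is measurable between the completed \<sigma>-algebras. Projections do, because
  cylinders over null sets are null.
\<close>

lemma lebesgue_measurable_of_null_vimage:
  fixes f :: "'a::euclidean_space \<Rightarrow> 'b::euclidean_space"
  assumes f: "f \<in> borel_measurable borel"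
    and null: "\<And>N. N \<in> null_sets lborel \<Longrightarrow> emeasure lborel (f -` N) = 0"
  shows "f \<in> lebesgue \<rightarrow>\<^sub>M lebesgue"
proof (rule complete_measure.measurable_completion2)
  show "complete_measure (lebesgue :: 'a measure)" by (rule completion.complete_measure_axioms)
  show meas: "f \<in> lebesgue \<rightarrow>\<^sub>M lborel"
    using f by (intro measurable_completion) simp
  have "N \<in> null_sets (distr lebesgue lborel f)" if N: "N \<in> null_sets lborel" for N
  proof -
    have "N \<in> sets borel" "f -` N \<in> sets borel"
      using N measurable_sets[OF f, of N] by auto
    then show ?thesis
      using null[OF N] meas by (auto simp: null_sets_def emeasure_distr)
  qed
  then show "null_sets lborel \<subseteq> null_sets (distr lebesgue lborel f)" by blast
qed

lemma fst_measurable_lebesgue: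
  "fst \<in> (lebesgue :: ('a::euclidean_space \<times> 'b::euclidean_space) measure) \<rightarrow>\<^sub>M lebesgue"
proof (rule lebesgue_measurable_of_null_vimage)
  show "(fst :: 'a \<times> 'b \<Rightarrow> 'a) \<in> borel_measurable borel"
    by (intro borel_measurable_continuous_onI continuous_intros)
  show "emeasure lborel (fst -` N :: ('a \<times> 'b) set) = 0" if "N \<in> null_sets lborel" for N :: "'a set"
  proof -
    have "emeasure (lborel \<Otimes>\<^sub>M lborel) (N \<times> (UNIV :: 'b set)) = 0"
      using that by (subst lborel.emeasure_pair_measure_Times) auto
    then show ?thesis by (simp add: vimage_fst lborel_prod)
  qed
qed

lemma snd_measurable_lebesgue:
  "snd \<in> (lebesgue :: ('a::euclidean_space \<times> 'b::euclidean_space) measure) \<rightarrow>\<^sub>M lebesgue"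
proof (rule lebesgue_measurable_of_null_vimage)
  show "(snd :: 'a \<times> 'b \<Rightarrow> 'b) \<in> borel_measurable borel"
    by (intro borel_measurable_continuous_onI continuous_intros)
  show "emeasure lborel (snd -` N :: ('a \<times> 'b) set) = 0" if "N \<in> null_sets lborel" for N :: "'b set"
  proof -
    have "emeasure (lborel \<Otimes>\<^sub>M lborel) ((UNIV :: 'a set) \<times> N) = 0"
      using that by (subst lborel.emeasure_pair_measure_Times) auto
    then show ?thesis by (simp add: vimage_snd lborel_prod)
  qed
qed

lemma fst_measurable_lebesgue_on:
  "fst \<in> lebesgue_on (A \<times> B) \<rightarrow>\<^sub>M lebesgue_on A" for A :: "'a::euclidean_space set" and B :: "'b::euclidean_space set"
  by (rule measurable_restrict_space3[OF fst_measurable_lebesgue]) auto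

lemma snd_measurable_lebesgue_on:
  "snd \<in> lebesgue_on (A \<times> B) \<rightarrow>\<^sub>M lebesgue_on B" for A :: "'a::euclidean_space set" and B :: "'b::euclidean_space set"
  by (rule measurable_restrict_space3[OF snd_measurable_lebesgue]) auto

text \<open>
  Transfers an almost everywhere statement on \<open>A\<close> to both coordinates of \<open>A \<times> A\<close>: the exceptional
  set lies in \<open>N \<times> UNIV \<union> UNIV \<times> N\<close> for a Borel null set \<open>N\<close>.
\<close>

lemma AE_lebesgue_on_Times:
  fixes A :: "'a::euclidean_space set"
  assumes A: "A \<in> sets borel" and P: "AE x in lebesgue_on A. P x"
  shows "AE z in lebesgue_on (A \<times> A). P (fst z) \<and> P (snd z)"
proof -
  have AA: "A \<times> A \<in> sets (lebesgue :: ('a \<times> 'a) measure)"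
    using A by (simp add: borel_Times)
  have "AE x in lborel. x \<in> A \<longrightarrow> P x"
    using P A by (simp add: AE_restrict_space_iff AE_completion_iff)
  then obtain N where N: "{x. \<not> (x \<in> A \<longrightarrow> P x)} \<subseteq> N" "N \<in> null_sets lborel"
    by (auto elim!: AE_E simp: null_sets_def)
  have 1: "N \<times> UNIV \<in> null_sets (lborel :: ('a \<times> 'a) measure)"
          "UNIV \<times> N \<in> null_sets (lborel :: ('a \<times> 'a) measure)"
    using N by (simp_all add: null_sets_def lborel_prod[symmetric] lborel.emeasure_pair_measure_Times)
  have "AE z in (lborel :: ('a \<times> 'a) measure). z \<in> A \<times> A \<longrightarrow> P (fst z) \<and> P (snd z)"
    by (rule AE_I'[OF null_sets.Un[OF 1]]) (use N(1) in auto)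
  then show ?thesis
    using AA by (subst AE_restrict_space_iff) (auto intro: AE_completion)
qed

section \<open>Power integrals and convergence in $L^p$\<close>

lemma abs_add_powr_le:
  fixes a b :: real
  assumes "0 \<le> p"
  shows "\<bar>a + b\<bar> powr p \<le> 2 powr p * (\<bar>a\<bar> powr p + \<bar>b\<bar> powr p)"
proof -
  have "\<bar>a + b\<bar> powr p \<le> (2 * max \<bar>a\<bar> \<bar>b\<bar>) powr p"
    using assms by (intro powr_mono2) auto
  also have "\<dots> = 2 powr p * max \<bar>a\<bar> \<bar>b\<bar> powr p" by (simp add: powr_mult)
  also have "max \<bar>a\<bar> \<bar>b\<bar> powr p \<le> \<bar>a\<bar> powr p + \<bar>b\<bar> powr p"
    by (cases "\<bar>a\<bar> \<le> \<bar>b\<bar>") (auto simp: max_def)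
  finally show ?thesis by (simp add: mult_left_mono)
qed

lemma Lp_diff:
  assumes "0 \<le> p" "u \<in> Lp p M" "v \<in> Lp p M"
  shows "(\<lambda>x. u x - v x) \<in> Lp p M"
proof -
  have [measurable]: "u \<in> borel_measurable M" "v \<in> borel_measurable M"
    and i: "integrable M (\<lambda>x. \<bar>u x\<bar> powr p)" "integrable M (\<lambda>x. \<bar>v x\<bar> powr p)"
    using assms by (auto simp: Lp_def)
  have "integrable M (\<lambda>x. \<bar>u x - v x\<bar> powr p)"
  proof (rule Bochner_Integration.integrable_bound)
    show "integrable M (\<lambda>x. 2 powr p * (\<bar>u x\<bar> powr p + \<bar>v x\<bar> powr p))" using i by simp
    show "AE x in M. norm (\<bar>u x - v x\<bar> powr p) \<le> norm (2 powr p * (\<bar>u x\<bar> powr p + \<bar>v x\<bar> powr p))"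
      using abs_add_powr_le[OF assms(1), of "u x" "- v x" for x] by simp
  qed simp
  then show ?thesis by (auto simp: Lp_def)
qed

text \<open>
  Convergence in \<open>L\<^sup>p\<close> is convergence of \<open>\<bar>u k - v\<bar> powr p\<close> to zero in \<open>L\<^sup>1\<close>, which has an almost
  everywhere convergent subsequence.
\<close>

lemma Lp_limit_AE_subseq:
  assumes p: "0 < p" and u: "\<And>k. u k \<in> Lp p M" and v: "v \<in> Lp p M"
    and lim: "(\<lambda>k. Lp_dist p M (u k) v) \<longlonglongrightarrow> 0"
  shows "\<exists>r. strict_mono (r :: nat \<Rightarrow> nat) \<and> (AE x in M. (\<lambda>k. u (r k) x) \<longlonglongrightarrow> v x)"
proof -
  let ?I = "\<lambda>k. \<integral>x. \<bar>u k x - v x\<bar> powr p \<partial>M"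
  have int: "integrable M (\<lambda>x. \<bar>u k x - v x\<bar> powr p)" for k
    using Lp_diff[OF less_imp_le[OF p] u v] by (simp add: Lp_def)
  have "?I k = Lp_dist p M (u k) v powr p" for k
    using p by (simp add: Lp_dist_def Lp_norm_def powr_powr)
  moreover have "(\<lambda>k. Lp_dist p M (u k) v powr p) \<longlonglongrightarrow> 0 powr p"
    by (rule tendsto_powr'[OF lim tendsto_const]) (use p in \<open>simp add: Lp_dist_def Lp_norm_def\<close>)
  ultimately have "?I \<longlonglongrightarrow> 0" using p by simp
  then have "\<exists>r. strict_mono (r :: nat \<Rightarrow> nat) \<and> (AE x in M. (\<lambda>k. \<bar>u (r k) x - v x\<bar> powr p) \<longlonglongrightarrow> 0)"
    using int by (intro tendsto_L1_AE_subseq) simp_all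
  then obtain r where r: "strict_mono (r :: nat \<Rightarrow> nat)"
    and AE: "AE x in M. (\<lambda>k. \<bar>u (r k) x - v x\<bar> powr p) \<longlonglongrightarrow> 0" by blast
  have "(\<lambda>k. u (r k) x) \<longlonglongrightarrow> v x" if "(\<lambda>k. \<bar>u (r k) x - v x\<bar> powr p) \<longlonglongrightarrow> 0" for x
  proof -
    have "(\<lambda>k. (\<bar>u (r k) x - v x\<bar> powr p) powr (1/p)) \<longlonglongrightarrow> 0 powr (1/p)"
      by (rule tendsto_powr'[OF that tendsto_const]) (use p in simp)
    then have "(\<lambda>k. \<bar>u (r k) x - v x\<bar>) \<longlonglongrightarrow> 0" using p by (simp add: powr_powr)
    then show ?thesis by (simp add: tendsto_rabs_zero_iff LIM_zero_iff)
  qed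
  then show ?thesis using r AE by (auto elim!: eventually_mono)
qed

text \<open>
  The \<open>p\<close>-th power of the \<open>L\<^sup>p\<close> distance, with values in \<open>[0, \<infinity>]\<close>. It is additive over disjoint pieces
  of the domain, and it obeys a triangle inequality up to the factor \<open>2 powr p\<close>.
\<close>

definition Lp_gap :: "real \<Rightarrow> 'a measure \<Rightarrow> ('a \<Rightarrow> real) \<Rightarrow> ('a \<Rightarrow> real) \<Rightarrow> ennreal" where
  "Lp_gap p M u v = (\<integral>\<^sup>+x. ennreal (\<bar>u x - v x\<bar> powr p) \<partial>M)"

lemma Lp_gap_commute: "Lp_gap p M u v = Lp_gap p M v u"
  by (simp add: Lp_gap_def abs_minus_commute)

lemma Lp_gap_triangle:
  assumes "0 \<le> p" "u \<in> borel_measurable M" "v \<in> borel_measurable M" "w \<in> borel_measurable M"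
  shows "Lp_gap p M u w \<le> ennreal (2 powr p) * (Lp_gap p M u v + Lp_gap p M v w)"
proof -
  note [measurable] = assms(2-)
  have le: "\<bar>u x - w x\<bar> powr p \<le> 2 powr p * (\<bar>u x - v x\<bar> powr p + \<bar>v x - w x\<bar> powr p)" for x
    using abs_add_powr_le[OF assms(1), of "u x - v x" "v x - w x"] by simp
  have "Lp_gap p M u w
      \<le> (\<integral>\<^sup>+x. ennreal (2 powr p) * (ennreal (\<bar>u x - v x\<bar> powr p) + ennreal (\<bar>v x - w x\<bar> powr p)) \<partial>M)"
    unfolding Lp_gap_def using le
    by (intro nn_integral_mono) (simp flip: ennreal_plus ennreal_mult add: ennreal_leI)
  also have "\<dots> = ennreal (2 powr p) * (Lp_gap p M u v + Lp_gap p M v w)"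
    unfolding Lp_gap_def by (simp add: nn_integral_cmult nn_integral_add)
  finally show ?thesis .
qed

lemma Lp_iff_gap_finite:
  "u \<in> Lp p M \<longleftrightarrow> u \<in> borel_measurable M \<and> Lp_gap p M u (\<lambda>_. 0) < \<infinity>"
  by (auto simp: Lp_def Lp_gap_def integrable_iff_bounded)

lemma Lp_gap_eq_Lp_dist:
  assumes p: "0 < p" and "u \<in> Lp p M" "v \<in> Lp p M"
  shows "Lp_gap p M u v = ennreal (Lp_dist p M u v powr p)"
proof -
  have "integrable M (\<lambda>x. \<bar>u x - v x\<bar> powr p)"
    using Lp_diff[of p u M v] assms by (simp add: Lp_def)
  then show ?thesis
    using p by (simp add: Lp_gap_def Lp_dist_def Lp_norm_def powr_powr nn_integral_eq_integral)
qed

lemma Lp_dist_tendsto_0I: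
  assumes p: "0 < p" and u: "\<And>k. u k \<in> Lp p M" and v: "v \<in> Lp p M"
    and gap: "\<And>\<epsilon>::real. 0 < \<epsilon> \<Longrightarrow> \<exists>N. \<forall>k\<ge>N. Lp_gap p M (u k) v \<le> ennreal \<epsilon>"
  shows "(\<lambda>k. Lp_dist p M (u k) v) \<longlonglongrightarrow> 0"
proof (rule metric_LIMSEQ_I)
  fix \<epsilon> :: real assume \<epsilon>: "0 < \<epsilon>"
  obtain N where N: "\<And>k. N \<le> k \<Longrightarrow> Lp_gap p M (u k) v \<le> ennreal ((\<epsilon> / 2) powr p)"
    using gap[of "(\<epsilon> / 2) powr p"] \<epsilon> by auto
  have "Lp_dist p M (u k) v \<le> \<epsilon> / 2" if "N \<le> k" for k
  proof -
    have "Lp_dist p M (u k) v powr p \<le> (\<epsilon> / 2) powr p"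
      using N[OF that] by (simp add: Lp_gap_eq_Lp_dist[OF p u v])
    then show ?thesis
      using powr_less_mono2[of p "\<epsilon> / 2" "Lp_dist p M (u k) v"] p \<epsilon> by fastforce
  qed
  moreover have "0 \<le> Lp_dist p M (u k) v" for k by (simp add: Lp_dist_def Lp_norm_def)
  ultimately show "\<exists>N. \<forall>k\<ge>N. dist (Lp_dist p M (u k) v) 0 < \<epsilon>"
    using \<epsilon> by (intro exI[of _ N]) (force simp: dist_real_def)
qed

section \<open>Lower semicontinuity and pointwise convergence of the energies\<close>

lemma energy_integrand_measurable:
  fixes u :: "real ^ 'n \<Rightarrow> real"
  assumes "u \<in> borel_measurable (lebesgue_on A)" "J \<in> borel_measurable (lebesgue_on (A \<times> A))"
  shows "(\<lambda>(x, y). ennreal (\<bar>u x - u y\<bar> powr p) * J (x, y)) \<in> borel_measurable (lebesgue_on (A \<times> A))"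
proof -
  have [measurable]: "(\<lambda>z. u (fst z)) \<in> borel_measurable (lebesgue_on (A \<times> A))"
       "(\<lambda>z. u (snd z)) \<in> borel_measurable (lebesgue_on (A \<times> A))"
    by (rule measurable_compose[OF fst_measurable_lebesgue_on assms(1)],
        rule measurable_compose[OF snd_measurable_lebesgue_on assms(1)])
  note [measurable] = assms(2)
  show ?thesis unfolding split_beta by simp
qed

text \<open>
  Multiplication is not continuous at \<open>0 * \<infinity>\<close>, and both values occur for the energies. For \<open>c < L\<close>
  eventually \<open>c \<le> a n\<close>, and multiplication by the finite number \<open>c\<close> commutes with the lower limit; then
  let \<open>c\<close> increase to \<open>L\<close>.
\<close>

lemma liminf_mult_ennreal_ge:
  fixes a b :: "nat \<Rightarrow> ennreal"
  assumes "a \<longlonglongrightarrow> L" and "B \<le> liminf b"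
  shows "L * B \<le> liminf (\<lambda>n. a n * b n)"
proof (cases "L = 0")
  case False
  have *: "c * B \<le> liminf (\<lambda>n. a n * b n)" if "c < L" for c
  proof -
    have "eventually (\<lambda>n. c < a n) sequentially"
      using assms(1) that by (rule order_tendstoD(1))
    then have ev: "eventually (\<lambda>n. c * b n \<le> a n * b n) sequentially"
      by eventually_elim (auto intro: mult_right_mono)
    have "c * B \<le> c * liminf b" using assms(2) by (rule mult_left_mono) simp
    also have "\<dots> = liminf (\<lambda>n. c * b n)"
    proof (rule Liminf_compose_continuous_mono[symmetric])
      show "continuous_on UNIV ((*) c)"
        using that by (intro ennreal_continuous_on_cmult continuous_on_id) (metis infinity_ennreal_def order_less_le_trans top_greatest)
      show "mono ((*) c)" by (simp add: mono_def mult_left_mono)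
    qed simp
    also have "\<dots> \<le> liminf (\<lambda>n. a n * b n)" by (rule Liminf_mono[OF ev])
    finally show ?thesis .
  qed
  have "L * B = (SUP c\<in>{..<L}. c) * B"
    using False by (simp add: Sup_lessThan zero_less_iff_neq_zero)
  also have "\<dots> = (SUP c\<in>{..<L}. c * B)"
    using SUP_mult_right_ennreal by blast
  also have "\<dots> \<le> liminf (\<lambda>n. a n * b n)" by (auto intro: SUP_least *)
  finally show ?thesis .
qed simp

text \<open>
  Fatou's lemma on \<open>A \<times> A\<close>. It needs almost everywhere convergence of the functions, so one first
  passes to a subsequence that realises the lower limit of the energies and then to a further one
  that converges almost everywhere.
\<close>

lemma energy_liminf:
  fixes u :: "nat \<Rightarrow> real ^ 'n \<Rightarrow> real"
  assumes p: "0 < p" and A: "A \<in> sets borel"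
    and Jk: "\<And>k. Jk k \<in> borel_measurable (lebesgue_on (A \<times> A))"
    and le: "AE z in lebesgue_on (A \<times> A). J z \<le> liminf (\<lambda>k. Jk k z)"
    and u: "\<And>k. u k \<in> Lp p (lebesgue_on A)" and v: "v \<in> Lp p (lebesgue_on A)"
    and lim: "(\<lambda>k. Lp_dist p (lebesgue_on A) (u k) v) \<longlonglongrightarrow> 0"
  shows "energy p A J v \<le> liminf (\<lambda>k. energy p A (Jk k) (u k))"
proof -
  obtain r where r: "strict_mono (r :: nat \<Rightarrow> nat)"
    and rl: "((\<lambda>k. energy p A (Jk k) (u k)) \<circ> r) \<longlonglongrightarrow> liminf (\<lambda>k. energy p A (Jk k) (u k))"
    using liminf_subseq_lim by blast
  have "(\<lambda>k. Lp_dist p (lebesgue_on A) (u (r k)) v) \<longlonglongrightarrow> 0"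
    using LIMSEQ_subseq_LIMSEQ[OF lim r] by (simp add: o_def)
  from Lp_limit_AE_subseq[OF p u v this]
  obtain s where s: "strict_mono (s :: nat \<Rightarrow> nat)"
    and AE: "AE x in lebesgue_on A. (\<lambda>k. u (r (s k)) x) \<longlonglongrightarrow> v x" by blast
  define t where "t = r \<circ> s"
  have t: "strict_mono t" using r s by (simp add: t_def strict_mono_o)
  have tl: "(\<lambda>k. energy p A (Jk (t k)) (u (t k))) \<longlonglongrightarrow> liminf (\<lambda>k. energy p A (Jk k) (u k))"
    using LIMSEQ_subseq_LIMSEQ[OF rl s] by (simp add: t_def o_def)
  have AE2: "AE z in lebesgue_on (A \<times> A).
      (\<lambda>(x, y). ennreal (\<bar>v x - v y\<bar> powr p) * J (x, y)) z
      \<le> liminf (\<lambda>k. (\<lambda>(x, y). ennreal (\<bar>u (t k) x - u (t k) y\<bar> powr p) * Jk (t k) (x, y)) z)"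
    using AE_lebesgue_on_Times[OF A AE] le
  proof eventually_elim
    case (elim z)
    obtain x y where z: "z = (x, y)" by (cases z)
    have l: "(\<lambda>k. \<bar>u (t k) x - u (t k) y\<bar>) \<longlonglongrightarrow> \<bar>v x - v y\<bar>"
      using elim(1) z by (auto simp: t_def intro!: tendsto_intros)
    have 1: "(\<lambda>k. ennreal (\<bar>u (t k) x - u (t k) y\<bar> powr p)) \<longlonglongrightarrow> ennreal (\<bar>v x - v y\<bar> powr p)"
      by (intro tendsto_ennrealI tendsto_powr'[OF l tendsto_const]) (use p in auto)
    have 2: "J z \<le> liminf (\<lambda>k. Jk (t k) z)"
      using elim(2) liminf_subseq_mono[OF t, of "\<lambda>k. Jk k z"] by (simp add: o_def)
    show ?case
      using liminf_mult_ennreal_ge[OF 1 2] by (simp add: z)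
  qed
  have m: "u k \<in> borel_measurable (lebesgue_on A)" for k using u by (simp add: Lp_def)
  have "energy p A J v \<le> (\<integral>\<^sup>+ z. liminf (\<lambda>k. (\<lambda>(x, y). ennreal (\<bar>u (t k) x - u (t k) y\<bar> powr p) * Jk (t k) (x, y)) z) \<partial>lebesgue_on (A \<times> A))"
    unfolding energy_def by (rule nn_integral_mono_AE[OF AE2])
  also have "\<dots> \<le> liminf (\<lambda>k. energy p A (Jk (t k)) (u (t k)))"
    unfolding energy_def by (intro nn_integral_liminf energy_integrand_measurable m Jk)
  also have "\<dots> = liminf (\<lambda>k. energy p A (Jk k) (u k))"
    by (rule lim_imp_Liminf[OF _ tl]) simp
  finally show ?thesis .
qed

lemma energy_dominated_convergence:
  fixes u :: "real ^ 'n \<Rightarrow> real"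
  assumes Jk: "\<And>k. Jk k \<in> borel_measurable (lebesgue_on (A \<times> A))"
    and J: "J \<in> borel_measurable (lebesgue_on (A \<times> A))"
    and W: "W \<in> borel_measurable (lebesgue_on (A \<times> A))"
    and lim: "AE z in lebesgue_on (A \<times> A). (\<lambda>k. Jk k z) \<longlonglongrightarrow> J z"
    and bound: "\<And>k. AE z in lebesgue_on (A \<times> A). Jk k z \<le> W z"
    and u: "u \<in> borel_measurable (lebesgue_on A)" and fin: "energy p A W u < \<infinity>"
  shows "(\<lambda>k. energy p A (Jk k) u) \<longlonglongrightarrow> energy p A J u"
  unfolding energy_def
proof (rule nn_integral_dominated_convergence)
  let ?f = "\<lambda>K (x, y). ennreal (\<bar>u x - u y\<bar> powr p) * K (x, y)"
  show "AE z in lebesgue_on (A \<times> A). ?f (Jk k) z \<le> ?f W z" for k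
    using bound[of k] by eventually_elim (auto intro: mult_left_mono)
  show "AE z in lebesgue_on (A \<times> A). (\<lambda>k. ?f (Jk k) z) \<longlonglongrightarrow> ?f J z"
    using lim by eventually_elim (auto intro!: ennreal_tendsto_cmult)
  show "nn_integral (lebesgue_on (A \<times> A)) (?f W) < \<infinity>" using fin by (simp add: energy_def)
qed (intro energy_integrand_measurable u Jk J W)+

lemma energy_cmult_kernel:
  fixes u :: "real ^ 'n \<Rightarrow> real"
  assumes "u \<in> borel_measurable (lebesgue_on A)" "J \<in> borel_measurable (lebesgue_on (A \<times> A))"
  shows "energy p A (\<lambda>z. c * J z) u = c * energy p A J u"
  unfolding energy_def nn_integral_cmult[OF energy_integrand_measurable[OF assms], symmetric]
  by (rule nn_integral_cong) (auto simp: ac_simps)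

lemma energy_add_kernel:
  fixes u :: "real ^ 'n \<Rightarrow> real"
  assumes "u \<in> borel_measurable (lebesgue_on A)" "J \<in> borel_measurable (lebesgue_on (A \<times> A))"
    "K \<in> borel_measurable (lebesgue_on (A \<times> A))"
  shows "energy p A (\<lambda>z. J z + K z) u = energy p A J u + energy p A K u"
  unfolding energy_def nn_integral_add[OF energy_integrand_measurable[OF assms(1,2)] 
    energy_integrand_measurable[OF assms(1,3)], symmetric]
  by (rule nn_integral_cong) (auto simp: distrib_left)

text \<open>
  On \<open>Hp\<close> the kernels increase to \<open>J\<close> and on \<open>Hm\<close> they decrease from \<open>Jk m\<close>. The sum of the two
  therefore dominates on both parts, and this majorant is measurable whatever the sets \<open>Hp\<close> and \<open>Hm\<close>
  are.
\<close>

lemma piecewise_monotone_kernels_bound: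
  assumes A: "A \<in> sets borel"
    and mono: "piecewise_monotone_kernels A Jk"
    and lim: "AE z in lebesgue_on (A \<times> A). (\<lambda>k. Jk k z) \<longlonglongrightarrow> J z"
  shows "AE z in lebesgue_on (A \<times> A). \<forall>k\<ge>m. Jk k z \<le> J z + Jk m z"
proof -
  obtain Hp Hm where null: "A \<times> A - (Hp \<union> Hm) \<in> null_sets lebesgue"
    and inc: "\<And>k. AE z in lebesgue. z \<in> Hp \<longrightarrow> Jk k z \<le> Jk (Suc k) z"
    and dec: "\<And>k. AE z in lebesgue. z \<in> Hm \<longrightarrow> Jk (Suc k) z \<le> Jk k z"
    using mono by (auto simp: piecewise_monotone_kernels_def)
  have AA: "A \<times> A \<in> sets lebesgue" using A by (simp add: borel_Times)
  have "AE z in lebesgue. z \<in> A \<times> A \<longrightarrow> z \<in> Hp \<union> Hm"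
    by (rule AE_I'[OF null]) auto
  moreover have "AE z in lebesgue. \<forall>k. z \<in> Hp \<longrightarrow> Jk k z \<le> Jk (Suc k) z"
    by (subst AE_all_countable) (intro allI inc)
  moreover have "AE z in lebesgue. \<forall>k. z \<in> Hm \<longrightarrow> Jk (Suc k) z \<le> Jk k z"
    by (subst AE_all_countable) (intro allI dec)
  moreover have "AE z in lebesgue. z \<in> A \<times> A \<longrightarrow> (\<lambda>k. Jk k z) \<longlonglongrightarrow> J z"
    using lim AA by (simp add: AE_restrict_space_iff)
  ultimately have "AE z in lebesgue. z \<in> A \<times> A \<longrightarrow> (\<forall>k\<ge>m. Jk k z \<le> J z + Jk m z)"
  proof eventually_elim
    case (elim z)
    show ?case
    proof (intro impI allI)
      fix k assume z: "z \<in> A \<times> A" and k: "m \<le> k"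
      from elim(1) z consider "z \<in> Hp" | "z \<in> Hm" by blast
      then show "Jk k z \<le> J z + Jk m z"
      proof cases
        case 1
        then have "incseq (\<lambda>k. Jk k z)" using elim(2) by (simp add: incseq_SucI)
        then have "Jk k z \<le> J z" using elim(4) z by (intro incseq_le) auto
        then show ?thesis by (simp add: add_increasing2)
      next
        case 2
        then have "decseq (\<lambda>k. Jk k z)" using elim(3) by (simp add: decseq_SucI)
        then have "Jk k z \<le> Jk m z" using k by (rule decseqD)
        then show ?thesis by (simp add: add_increasing)
      qed
    qed
  qed
  then show ?thesis using AA by (simp add: AE_restrict_space_iff)
qed

text \<open>
  Dominated convergence, with majorant \<open>C * J\<close> for dominated kernels and \<open>J + Jk m\<close> for piecewise
  monotone ones, where \<open>m\<close> is an index at which the energy of \<open>u\<close> is finite.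
\<close>

lemma energy_pointwise_convergence:
  fixes u :: "real ^ 'n \<Rightarrow> real"
  assumes A: "A \<in> sets borel"
    and Jk: "\<And>k. Jk k \<in> borel_measurable (lebesgue_on (A \<times> A))"
    and J: "J \<in> borel_measurable (lebesgue_on (A \<times> A))"
    and lim: "AE z in lebesgue_on (A \<times> A). (\<lambda>k. Jk k z) \<longlonglongrightarrow> J z"
    and u: "u \<in> borel_measurable (lebesgue_on A)" and fin: "energy p A J u < \<infinity>"
    and dom: "dominated_kernels A Jk J \<or>
      (piecewise_monotone_kernels A Jk \<and> (\<exists>k. energy p A (Jk k) u < \<infinity>))"
  shows "(\<lambda>k. energy p A (Jk k) u) \<longlonglongrightarrow> energy p A J u"
  using dom
proof (elim disjE conjE exE)
  assume "dominated_kernels A Jk J"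
  then obtain C :: real where C: "AE z in lebesgue_on (A \<times> A). (SUP k. Jk k z) \<le> ennreal C * J z"
    by (auto simp: dominated_kernels_def)
  show ?thesis
  proof (rule energy_dominated_convergence[OF Jk J _ lim _ u])
    show "(\<lambda>z. ennreal C * J z) \<in> borel_measurable (lebesgue_on (A \<times> A))"
      using J by simp
    show "AE z in lebesgue_on (A \<times> A). Jk k z \<le> ennreal C * J z" for k
      using C by eventually_elim (simp add: SUP_le_iff)
    show "energy p A (\<lambda>z. ennreal C * J z) u < \<infinity>"
      using fin by (simp add: energy_cmult_kernel[OF u J] ennreal_mult_less_top)
  qed
next
  fix m assume "piecewise_monotone_kernels A Jk" and m: "energy p A (Jk m) u < \<infinity>"
  from piecewise_monotone_kernels_bound[OF A this(1) lim]
  have B: "AE z in lebesgue_on (A \<times> A). \<forall>k\<ge>m. Jk k z \<le> J z + Jk m z" .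
  have "(\<lambda>k. energy p A (Jk (k + m)) u) \<longlonglongrightarrow> energy p A J u"
  proof (rule energy_dominated_convergence[OF Jk J _ _ _ u])
    show "(\<lambda>z. J z + Jk m z) \<in> borel_measurable (lebesgue_on (A \<times> A))"
      using J Jk by simp
    show "AE z in lebesgue_on (A \<times> A). (\<lambda>k. Jk (k + m) z) \<longlonglongrightarrow> J z"
      using lim by eventually_elim (rule LIMSEQ_ignore_initial_segment)
    show "AE z in lebesgue_on (A \<times> A). Jk (k + m) z \<le> J z + Jk m z" for k
      using B by eventually_elim simp
    show "energy p A (\<lambda>z. J z + Jk m z) u < \<infinity>"
      using fin m by (simp add: energy_add_kernel[OF u J Jk])
  qed
  then show ?thesis by (rule LIMSEQ_offset)
qed

section \<open>Completeness and compactness in $L^p$\<close>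

text \<open>
  Total boundedness implies the existence of Cauchy subsequences. Finite coverings appear here as
  colourings of the indices, the form in which rounding the values of step functions supplies them.
  At every scale the pigeonhole principle gives a monochromatic subsequence, and a diagonal sequence
  serves all scales at once.
\<close>

lemma Cauchy_subseq_of_finite_colourings:
  fixes D :: "nat \<Rightarrow> nat \<Rightarrow> ennreal"
  assumes col: "\<And>\<epsilon>::real. 0 < \<epsilon> \<Longrightarrow>
    \<exists>c :: nat \<Rightarrow> 'c. finite (range c) \<and> (\<forall>i j. c i = c j \<longrightarrow> D i j \<le> ennreal \<epsilon>)"
  shows "\<exists>r. strict_mono (r :: nat \<Rightarrow> nat) \<and>
    (\<forall>\<epsilon>>0. \<exists>N. \<forall>i\<ge>N. \<forall>j\<ge>N. D (r i) (r j) \<le> ennreal \<epsilon>)"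
proof -
  define P where "P n s \<longleftrightarrow> (\<forall>i j. D (s i) (s j) \<le> ennreal (1 / Suc n))"
    for n :: nat and s :: "nat \<Rightarrow> nat"
  interpret subseqs P
  proof
    fix n and s :: "nat \<Rightarrow> nat" assume s: "strict_mono s"
    obtain c :: "nat \<Rightarrow> 'c" where fin: "finite (range c)"
      and c: "\<And>i j. c i = c j \<Longrightarrow> D i j \<le> ennreal (1 / Suc n)"
      using col[of "1 / Suc n"] by auto
    have "finite ((c \<circ> s) ` UNIV)"
      by (rule finite_subset[OF _ fin]) auto
    from pigeonhole_infinite[OF infinite_UNIV_nat this]
    obtain a where "infinite {i. c (s i) = c (s a)}" by auto
    from infinite_enumerate[OF this]
    obtain r where r: "strict_mono (r :: nat \<Rightarrow> nat)" "\<And>i. c (s (r i)) = c (s a)" by auto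
    have "P n (s \<circ> r)" using c r(2) by (simp add: P_def)
    with r(1) show "\<exists>r'. strict_mono r' \<and> P n (s \<circ> r')" by blast
  qed
  have D: "D (diagseq (Suc n + i)) (diagseq (Suc n + j)) \<le> ennreal (1 / Suc n)" for n i j
    using diagseq_holds[of n] by (simp add: P_def)
  show ?thesis
  proof (intro exI[of _ diagseq] conjI allI impI)
    show "strict_mono diagseq" by (rule subseq_diagseq)
    fix \<epsilon> :: real assume "0 < \<epsilon>"
    then obtain n where n: "1 / Suc n < \<epsilon>"
      using nat_approx_posE by metis
    show "\<exists>N. \<forall>i\<ge>N. \<forall>j\<ge>N. D (diagseq i) (diagseq j) \<le> ennreal \<epsilon>"
    proof (intro exI[of _ "Suc n"] allI impI)
      fix i j assume ij: "Suc n \<le> i" "Suc n \<le> j"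
      have "D (diagseq i) (diagseq j) \<le> ennreal (1 / Suc n)"
        using D[of n "i - Suc n" "j - Suc n"] ij by simp
      also have "\<dots> \<le> ennreal \<epsilon>" using n by (intro ennreal_leI) simp
      finally show "D (diagseq i) (diagseq j) \<le> ennreal \<epsilon>" .
    qed
  qed
qed

text \<open>
  The bound depends on \<open>u\<close> only through its norm and the approximation error, so along a bounded
  sequence the approximating constants stay bounded.
\<close>

lemma constant_bound_of_gap:
  fixes a b c V :: real
  assumes p: "1 \<le> p" and u: "u \<in> borel_measurable M"
    and V: "emeasure M (space M) = ennreal V" "0 < V"
    and gap: "Lp_gap p M u (\<lambda>_. c) \<le> ennreal a" "Lp_gap p M u (\<lambda>_. 0) \<le> ennreal b" "0 \<le> a" "0 \<le> b"
  shows "\<bar>c\<bar> \<le> (2 powr p * (a + b) / V) powr (1 / p)"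
proof -
  have "ennreal (\<bar>c\<bar> powr p * V) = Lp_gap p M (\<lambda>_. c) (\<lambda>_. 0)"
    using V by (simp add: Lp_gap_def ennreal_mult)
  also have "\<dots> \<le> ennreal (2 powr p) * (Lp_gap p M (\<lambda>_. c) u + Lp_gap p M u (\<lambda>_. 0))"
    using p u by (intro Lp_gap_triangle) auto
  also have "\<dots> \<le> ennreal (2 powr p) * (ennreal a + ennreal b)"
    using gap by (intro mult_left_mono add_mono) (auto simp: Lp_gap_commute[of p M "\<lambda>_. c"])
  also have "\<dots> = ennreal (2 powr p * (a + b))"
    using gap by (simp flip: ennreal_plus ennreal_mult)
  finally have "\<bar>c\<bar> powr p * V \<le> 2 powr p * (a + b)"
    using gap by (simp add: ennreal_le_iff)
  then have "\<bar>c\<bar> powr p \<le> 2 powr p * (a + b) / V" using V by (simp add: field_simps)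
  then have "(\<bar>c\<bar> powr p) powr (1 / p) \<le> (2 powr p * (a + b) / V) powr (1 / p)"
    using p by (intro powr_mono2) auto
  then show ?thesis using p by (simp add: powr_powr)
qed

text \<open>
  Along a fast subsequence, with increments \<open>d k\<close>, the sum of \<open>(2 ^ k * \<bar>d k x\<bar>) powr p\<close> over \<open>k\<close> has a
  finite integral. As \<open>\<bar>d k x\<bar> \<le> (1/2) ^ k + (2 ^ k * \<bar>d k x\<bar>) powr p\<close>, the subsequence converges almost
  everywhere, and Fatou's lemma turns the Cauchy property into convergence of the whole sequence.
\<close>

lemma Lp_complete:
  assumes p: "1 \<le> p" and w: "\<And>k. w k \<in> Lp p M"
    and Cauchy: "\<And>\<epsilon>::real. 0 < \<epsilon> \<Longrightarrow> \<exists>N. \<forall>i\<ge>N. \<forall>j\<ge>N. Lp_gap p M (w i) (w j) \<le> ennreal \<epsilon>"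
  shows "\<exists>v\<in>Lp p M. (\<lambda>k. Lp_dist p M (w k) v) \<longlonglongrightarrow> 0"
proof -
  have [measurable]: "w k \<in> borel_measurable M" for k using w by (simp add: Lp_def)
  \<comment> \<open>The weight \<open>(2 ^ k) powr p\<close> is cancelled and a summable factor is left over.\<close>
  define e :: "nat \<Rightarrow> real" where "e k = (1/2) ^ k / (2 ^ k) powr p" for k
  have e: "0 < e k" for k by (simp add: e_def)
  have "\<forall>k. \<exists>N. \<forall>i\<ge>N. \<forall>j\<ge>N. Lp_gap p M (w i) (w j) \<le> ennreal (e k)"
    using Cauchy[OF e] by blast
  then obtain N where N: "\<And>k i j. N k \<le> i \<Longrightarrow> N k \<le> j \<Longrightarrow> Lp_gap p M (w i) (w j) \<le> ennreal (e k)"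
    by metis
  define t where "t k = k + (\<Sum>i\<le>k. N i)" for k
  have tN: "N k \<le> t k" for k
    unfolding t_def by (simp add: member_le_sum trans_le_add2)
  have tS: "t k \<le> t (Suc k)" for k by (simp add: t_def)
  have tk: "k \<le> t k" for k by (simp add: t_def)
  define d where "d k x = w (t (Suc k)) x - w (t k) x" for k x
  have dm [measurable]: "d k \<in> borel_measurable M" for k unfolding d_def by measurable
  have gap: "(\<integral>\<^sup>+x. ennreal (\<bar>d k x\<bar> powr p) \<partial>M) \<le> ennreal (e k)" for k
    using N[of k "t (Suc k)" "t k"] tN[of k] tS[of k] by (simp add: Lp_gap_def d_def)
  let ?g = "\<lambda>k x. ennreal ((2 ^ k) powr p) * ennreal (\<bar>d k x\<bar> powr p)"
  have "(\<integral>\<^sup>+x. (\<Sum>k. ?g k x) \<partial>M) = (\<Sum>k. \<integral>\<^sup>+x. ?g k x \<partial>M)"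
    by (rule nn_integral_suminf) measurable
  also have "\<dots> \<le> (\<Sum>k. ennreal ((1/2) ^ k))"
  proof (intro suminf_le summableI)
    fix k
    have "(\<integral>\<^sup>+x. ?g k x \<partial>M) = ennreal ((2 ^ k) powr p) * (\<integral>\<^sup>+x. ennreal (\<bar>d k x\<bar> powr p) \<partial>M)"
      by (rule nn_integral_cmult) measurable
    also have "\<dots> \<le> ennreal ((2 ^ k) powr p) * ennreal (e k)"
      by (intro mult_left_mono gap) simp
    also have "\<dots> = ennreal ((1/2) ^ k)"
      by (subst ennreal_mult[symmetric]) (auto simp: e_def)
    finally show "(\<integral>\<^sup>+x. ?g k x \<partial>M) \<le> ennreal ((1/2) ^ k)" .
  qed
  also have "\<dots> = ennreal 2"
    using geometric_sums[of "1/2 :: real"] by (intro suminf_ennreal_eq) simp_all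
  finally have "(\<integral>\<^sup>+x. (\<Sum>k. ?g k x) \<partial>M) \<noteq> \<infinity>" by (auto simp: top_unique)
  then have "AE x in M. (\<Sum>k. ?g k x) \<noteq> \<infinity>"
    by (intro nn_integral_PInf_AE) measurable
  then have conv: "AE x in M. (\<lambda>k. w (t k) x) \<longlonglongrightarrow> lim (\<lambda>k. w (t k) x)"
  proof eventually_elim
    case (elim x)
    have 1: "summable (\<lambda>k. (2 ^ k) powr p * \<bar>d k x\<bar> powr p)"
    proof (rule summable_suminf_not_top)
      show "(\<Sum>k. ennreal ((2 ^ k) powr p * \<bar>d k x\<bar> powr p)) \<noteq> top"
        using elim by (simp add: ennreal_mult)
    qed simp
    have "summable (\<lambda>k. (1/2) ^ k + (2 ^ k) powr p * \<bar>d k x\<bar> powr p)"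
      by (intro summable_add 1 summable_geometric) simp
    then have "summable (\<lambda>k. d k x)"
    proof (rule summable_comparison_test'[where N = 0])
      fix k :: nat
      show "norm (d k x) \<le> (1/2) ^ k + (2 ^ k) powr p * \<bar>d k x\<bar> powr p"
      proof (cases "2 ^ k * \<bar>d k x\<bar> \<le> 1")
        case True
        then have "\<bar>d k x\<bar> \<le> (1/2) ^ k" by (simp add: field_simps power_divide)
        then show ?thesis by (simp add: add_increasing2)
      next
        case False
        have "\<bar>d k x\<bar> \<le> 2 ^ k * \<bar>d k x\<bar>"
          by (simp add: mult_le_cancel_right1)
        also have "\<dots> = (2 ^ k * \<bar>d k x\<bar>) powr 1" by simp
        also have "\<dots> \<le> (2 ^ k * \<bar>d k x\<bar>) powr p"
          using False p by (intro powr_mono) auto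
        also have "\<dots> = (2 ^ k) powr p * \<bar>d k x\<bar> powr p" by (simp add: powr_mult)
        finally show ?thesis by (simp add: add_increasing)
      qed
    qed
    then have "summable (\<lambda>k. w (t (Suc k)) x - w (t k) x)" by (simp add: d_def)
    then have "convergent (\<lambda>k. w (t k) x - w (t 0) x)"
      by (simp add: summable_iff_convergent sum_lessThan_telescope[of "\<lambda>k. w (t k) x"])
    then have "convergent (\<lambda>k. w (t k) x)" by (simp add: convergent_diff_const_right_iff)
    then show ?case by (simp add: convergent_LIMSEQ_iff)
  qed
  define v where "v x = lim (\<lambda>k. w (t k) x)" for x
  have [measurable]: "v \<in> borel_measurable M" unfolding v_def by measurable
  have gapv: "Lp_gap p M (w i) v \<le> ennreal \<epsilon>"
    if c: "\<And>j. n \<le> j \<Longrightarrow> Lp_gap p M (w i) (w j) \<le> ennreal \<epsilon>" for n i \<epsilon>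
  proof -
    have "Lp_gap p M (w i) v
        = (\<integral>\<^sup>+x. liminf (\<lambda>k. ennreal (\<bar>w i x - w (t k) x\<bar> powr p)) \<partial>M)"
      unfolding Lp_gap_def
    proof (rule nn_integral_cong_AE)
      show "AE x in M. ennreal (\<bar>w i x - v x\<bar> powr p)
          = liminf (\<lambda>k. ennreal (\<bar>w i x - w (t k) x\<bar> powr p))"
        using conv
      proof eventually_elim
        case (elim x)
        have l: "(\<lambda>k. \<bar>w i x - w (t k) x\<bar>) \<longlonglongrightarrow> \<bar>w i x - v x\<bar>"
          using elim unfolding v_def by (intro tendsto_intros)
        have "(\<lambda>k. ennreal (\<bar>w i x - w (t k) x\<bar> powr p)) \<longlonglongrightarrow> ennreal (\<bar>w i x - v x\<bar> powr p)"
          by (intro tendsto_ennrealI tendsto_powr'[OF l tendsto_const]) (use p in auto)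
        then show ?case by (intro lim_imp_Liminf[symmetric]) simp_all
      qed
    qed
    also have "\<dots> \<le> liminf (\<lambda>k. Lp_gap p M (w i) (w (t k)))"
      unfolding Lp_gap_def by (rule nn_integral_liminf) measurable
    also have "\<dots> \<le> liminf (\<lambda>k::nat. ennreal \<epsilon>)"
      using c tk by (intro Liminf_mono eventually_sequentiallyI[of n]) (meson le_trans)
    finally show ?thesis by (simp add: Liminf_const)
  qed
  obtain n where n: "\<And>j. n \<le> j \<Longrightarrow> Lp_gap p M (w n) (w j) \<le> ennreal 1"
    using Cauchy[of 1] by auto
  have "Lp_gap p M v (\<lambda>_. 0) \<le> ennreal (2 powr p) * (Lp_gap p M v (w n) + Lp_gap p M (w n) (\<lambda>_. 0))"
    using p by (intro Lp_gap_triangle) auto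
  also have "\<dots> < \<infinity>"
    using le_less_trans[OF gapv[OF n] ennreal_less_top] w[of n]
    by (auto simp: Lp_iff_gap_finite ennreal_mult_less_top Lp_gap_commute[of p M v "w n"])
  finally have v: "v \<in> Lp p M" by (simp add: Lp_iff_gap_finite)
  have "(\<lambda>k. Lp_dist p M (w k) v) \<longlonglongrightarrow> 0"
  proof (rule Lp_dist_tendsto_0I[OF _ w v])
    fix \<epsilon> :: real assume "0 < \<epsilon>"
    with Cauchy obtain N where "\<forall>i\<ge>N. \<forall>j\<ge>N. Lp_gap p M (w i) (w j) \<le> ennreal \<epsilon>" by blast
    then show "\<exists>N. \<forall>k\<ge>N. Lp_gap p M (w k) v \<le> ennreal \<epsilon>"
      by (intro exI[of _ N]) (auto intro: gapv)
  qed (use p in simp)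
  with v show ?thesis by blast
qed

text \<open>
  Two functions that are close to step functions on the same pieces, with nearly equal values on
  each piece, are close to each other. For \<open>\<eta> \<le> 1 \<le> p\<close> one has \<open>\<eta> powr p \<le> \<eta>\<close>, so the error from
  the values is at most \<open>\<eta>\<close> times the total volume.
\<close>

lemma step_approximation_gap:
  assumes p: "1 \<le> p" and [measurable]: "u \<in> borel_measurable M" "v \<in> borel_measurable M"
    and I: "finite I" and Q: "\<And>i. i \<in> I \<Longrightarrow> Q i \<in> sets M" and cover: "space M \<subseteq> (\<Union>i\<in>I. Q i)"
    and bu: "(\<Sum>i\<in>I. \<integral>\<^sup>+x\<in>Q i. ennreal (\<bar>u x - b i\<bar> powr p) \<partial>M) \<le> ennreal \<epsilon>"
    and cv: "(\<Sum>i\<in>I. \<integral>\<^sup>+x\<in>Q i. ennreal (\<bar>v x - c i\<bar> powr p) \<partial>M) \<le> ennreal \<epsilon>"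
    and bc: "\<And>i. i \<in> I \<Longrightarrow> \<bar>b i - c i\<bar> \<le> \<eta>" and \<eta>: "0 \<le> \<eta>" "\<eta> \<le> 1"
    and vol: "ennreal \<eta> * (\<Sum>i\<in>I. emeasure M (Q i)) \<le> ennreal \<epsilon>"
    and \<epsilon>: "0 \<le> \<epsilon>"
  shows "Lp_gap p M u v \<le> ennreal (3 * 4 powr p * \<epsilon>)"
proof -
  have pt: "\<bar>u x - v x\<bar> powr p \<le> 4 powr p * (\<bar>u x - b i\<bar> powr p + \<bar>v x - c i\<bar> powr p + \<eta>)"
    if "i \<in> I" for x i
  proof -
    have [simp]: "(4::real) powr p = 2 powr p * 2 powr p" by (simp flip: powr_mult)
    have p2: "1 \<le> 2 powr p" using p by (simp add: ge_one_powr_ge_zero)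
    have "\<bar>b i - c i\<bar> powr p \<le> \<eta> powr p" using bc[OF that] p by (intro powr_mono2) auto
    also have "\<eta> powr p \<le> \<eta> powr 1" using \<eta> p by (intro powr_mono') auto
    finally have 1: "\<bar>b i - c i\<bar> powr p \<le> \<eta>" using \<eta> by simp
    have "\<bar>u x - v x\<bar> powr p \<le> 2 powr p * (\<bar>u x - b i\<bar> powr p + \<bar>(c i - v x) + (b i - c i)\<bar> powr p)"
      using abs_add_powr_le[of p "u x - b i" "(c i - v x) + (b i - c i)"] p by simp
    also have "\<dots> \<le> 2 powr p * (2 powr p * \<bar>u x - b i\<bar> powr p
        + 2 powr p * (\<bar>c i - v x\<bar> powr p + \<bar>b i - c i\<bar> powr p))"
      using p p2 by (intro mult_left_mono add_mono abs_add_powr_le mult_le_cancel_right1[THEN iffD2]) auto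
    also have "\<dots> \<le> 2 powr p * (2 powr p * \<bar>u x - b i\<bar> powr p
        + 2 powr p * (\<bar>v x - c i\<bar> powr p + \<eta>))"
      using 1 by (intro mult_left_mono add_mono) (auto simp: abs_minus_commute)
    finally show ?thesis by (simp add: algebra_simps)
  qed
  let ?f = "\<lambda>i x. ennreal (\<bar>u x - b i\<bar> powr p) * indicator (Q i) x"
  let ?g = "\<lambda>i x. ennreal (\<bar>v x - c i\<bar> powr p) * indicator (Q i) x"
  have [measurable]: "i \<in> I \<Longrightarrow> ?f i \<in> borel_measurable M" "i \<in> I \<Longrightarrow> ?g i \<in> borel_measurable M"
    "i \<in> I \<Longrightarrow> indicator (Q i) \<in> borel_measurable M" for i
    using Q by auto
  have "Lp_gap p M u v \<le> (\<integral>\<^sup>+x. (\<Sum>i\<in>I. ennreal (4 powr p) * (?f i x + ?g i x + ennreal \<eta> * indicator (Q i) x)) \<partial>M)"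
    unfolding Lp_gap_def
  proof (rule nn_integral_mono)
    fix x assume "x \<in> space M"
    then obtain i where i: "i \<in> I" "x \<in> Q i" using cover by auto
    have "ennreal (\<bar>u x - v x\<bar> powr p) \<le> ennreal (4 powr p) * (?f i x + ?g i x + ennreal \<eta> * indicator (Q i) x)"
      using pt[OF i(1), of x] i(2) \<eta> by (simp flip: ennreal_plus ennreal_mult add: ennreal_leI)
    also have "\<dots> \<le> (\<Sum>i\<in>I. ennreal (4 powr p) * (?f i x + ?g i x + ennreal \<eta> * indicator (Q i) x))"
      using i I by (intro member_le_sum) auto
    finally show "ennreal (\<bar>u x - v x\<bar> powr p) \<le> \<dots>" .
  qed
  also have "\<dots> = ennreal (4 powr p) * ((\<Sum>i\<in>I. integral\<^sup>N M (?f i)) + (\<Sum>i\<in>I. integral\<^sup>N M (?g i))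
      + ennreal \<eta> * (\<Sum>i\<in>I. emeasure M (Q i)))"
    using Q by (simp add: nn_integral_sum nn_integral_cmult nn_integral_add sum_distrib_left sum.distrib distrib_left
        nn_integral_cmult_indicator cong: sum.cong)
  also have "\<dots> \<le> ennreal (4 powr p) * (ennreal \<epsilon> + ennreal \<epsilon> + ennreal \<epsilon>)"
    by (intro mult_left_mono add_mono bu cv vol) simp
  also have "\<dots> = ennreal (3 * 4 powr p * \<epsilon>)"
    using \<epsilon> by (simp flip: ennreal_plus ennreal_mult add: algebra_simps)
  finally show ?thesis .
qed

text \<open>
  Boundedness of the values leaves finitely many step functions after rounding to multiples of a
  small \<open>\<eta>\<close>. The rounded values colour the indices, and indices of the same colour have close
  functions; hence every subsequence has a Cauchy subsequence, which converges by completeness.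
\<close>

lemma Lp_compact_seq_of_step_approximation:
  fixes u :: "nat \<Rightarrow> 'a \<Rightarrow> real"
  assumes p: "1 \<le> p" and u: "\<And>k. u k \<in> Lp p M"
    and approx: "\<And>\<epsilon>::real. 0 < \<epsilon> \<Longrightarrow> \<exists>(I :: 'i set) Q B. finite I \<and>
      (\<forall>i\<in>I. Q i \<in> sets M \<and> emeasure M (Q i) < \<infinity>) \<and> space M \<subseteq> (\<Union>i\<in>I. Q i) \<and>
      (\<forall>k. \<exists>c. (\<forall>i\<in>I. \<bar>c i\<bar> \<le> B) \<and>
        (\<Sum>i\<in>I. \<integral>\<^sup>+x\<in>Q i. ennreal (\<bar>u k x - c i\<bar> powr p) \<partial>M) \<le> ennreal \<epsilon>)"
  shows "Lp_compact_seq p M u"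
  unfolding Lp_compact_seq_def
proof (intro conjI allI impI u)
  fix r :: "nat \<Rightarrow> nat" assume "strict_mono r"
  have meas: "u k \<in> borel_measurable M" for k using u by (simp add: Lp_def)
  have "\<exists>s. strict_mono (s :: nat \<Rightarrow> nat) \<and> (\<forall>\<epsilon>>0. \<exists>N. \<forall>i\<ge>N. \<forall>j\<ge>N.
      Lp_gap p M (u (r (s i))) (u (r (s j))) \<le> ennreal \<epsilon>)"
  proof (rule Cauchy_subseq_of_finite_colourings)
    fix \<epsilon>' :: real assume \<epsilon>': "0 < \<epsilon>'"
    define \<epsilon> where "\<epsilon> = \<epsilon>' / (3 * 4 powr p)"
    have \<epsilon>: "0 < \<epsilon>" using \<epsilon>' by (simp add: \<epsilon>_def)
    obtain I :: "'i set" and Q B where IQ: "finite I \<and>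
      (\<forall>i\<in>I. Q i \<in> sets M \<and> emeasure M (Q i) < \<infinity>) \<and> space M \<subseteq> (\<Union>i\<in>I. Q i) \<and>
      (\<forall>k. \<exists>c. (\<forall>i\<in>I. \<bar>c i\<bar> \<le> B) \<and>
        (\<Sum>i\<in>I. \<integral>\<^sup>+x\<in>Q i. ennreal (\<bar>u k x - c i\<bar> powr p) \<partial>M) \<le> ennreal \<epsilon>)"
      using approx[OF \<epsilon>] by (elim exE) (rule that)
    then have I: "finite I" and Q: "\<And>i. i \<in> I \<Longrightarrow> Q i \<in> sets M" "\<And>i. i \<in> I \<Longrightarrow> emeasure M (Q i) < \<infinity>"
      and cover: "space M \<subseteq> (\<Union>i\<in>I. Q i)" by simp_all
    obtain c where "\<forall>k. (\<forall>i\<in>I. \<bar>c k i\<bar> \<le> B) \<and>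
        (\<Sum>i\<in>I. \<integral>\<^sup>+x\<in>Q i. ennreal (\<bar>u k x - c k i\<bar> powr p) \<partial>M) \<le> ennreal \<epsilon>"
      using IQ[THEN conjunct2, THEN conjunct2, THEN conjunct2, THEN choice] by (elim exE) (rule that)
    then have cB: "\<And>k i. i \<in> I \<Longrightarrow> \<bar>c k i\<bar> \<le> B"
      and c: "\<And>k. (\<Sum>i\<in>I. \<integral>\<^sup>+x\<in>Q i. ennreal (\<bar>u k x - c k i\<bar> powr p) \<partial>M) \<le> ennreal \<epsilon>"
      by simp_all
    define V where "V = (\<Sum>i\<in>I. measure M (Q i))"
    have V: "(\<Sum>i\<in>I. emeasure M (Q i)) = ennreal V" "0 \<le> V"
      using Q by (auto simp: V_def emeasure_eq_ennreal_measure less_top sum_ennreal sum_nonneg cong: sum.cong)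
    define \<eta> where "\<eta> = min 1 (\<epsilon> / (V + 1))"
    have \<eta>: "0 < \<eta>" "\<eta> \<le> 1" using \<epsilon> V(2) by (auto simp: \<eta>_def)
    have "\<eta> * V \<le> \<epsilon> / (V + 1) * V" using V(2) by (intro mult_right_mono) (auto simp: \<eta>_def)
    also have "\<dots> \<le> \<epsilon>" using \<epsilon> V(2) by (simp add: field_simps)
    finally have vol: "ennreal \<eta> * (\<Sum>i\<in>I. emeasure M (Q i)) \<le> ennreal \<epsilon>"
      using \<eta> V by (simp flip: ennreal_mult add: ennreal_leI)
    define col where "col k = (\<lambda>i. if i \<in> I then \<lfloor>c (r k) i / \<eta>\<rfloor> else 0)" for k
    show "\<exists>c :: nat \<Rightarrow> 'i \<Rightarrow> int. finite (range c) \<and>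
        (\<forall>i j. c i = c j \<longrightarrow> Lp_gap p M (u (r i)) (u (r j)) \<le> ennreal \<epsilon>')"
    proof (intro exI[of _ col] conjI allI impI)
      have "range col \<subseteq> {f. \<forall>i. (i \<in> I \<longrightarrow> f i \<in> {\<lfloor>- B / \<eta>\<rfloor>..\<lfloor>B / \<eta>\<rfloor>}) \<and> (i \<notin> I \<longrightarrow> f i = 0)}"
      proof -
        have "\<lfloor>- B / \<eta>\<rfloor> \<le> \<lfloor>c k i / \<eta>\<rfloor> \<and> \<lfloor>c k i / \<eta>\<rfloor> \<le> \<lfloor>B / \<eta>\<rfloor>" if "i \<in> I" for k i
          using cB[OF that, of k] \<eta> by (intro conjI floor_mono divide_right_mono) auto
        then show ?thesis by (auto simp: col_def)
      qed
      then show "finite (range col)"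
        by (rule finite_subset) (intro finite_set_of_finite_funs I finite_atLeastAtMost_int)
    next
      fix k l assume eq: "col k = col l"
      have "\<bar>c (r k) i - c (r l) i\<bar> \<le> \<eta>" if "i \<in> I" for i
      proof -
        have "\<lfloor>c (r k) i / \<eta>\<rfloor> = \<lfloor>c (r l) i / \<eta>\<rfloor>"
          using fun_cong[OF eq, of i] that by (simp add: col_def)
        then have "\<bar>c (r k) i / \<eta> - c (r l) i / \<eta>\<bar> \<le> 1" by linarith
        then have "\<bar>(c (r k) i - c (r l) i) / \<eta>\<bar> \<le> 1" by (simp only: diff_divide_distrib)
        then show ?thesis using \<eta> by (simp add: abs_divide)
      qed
      then have "Lp_gap p M (u (r k)) (u (r l)) \<le> ennreal (3 * 4 powr p * \<epsilon>)"
        using \<eta> \<epsilon> Q(1) cover vol by (intro step_approximation_gap[OF p meas meas I _ _ c c]) auto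
      then show "Lp_gap p M (u (r k)) (u (r l)) \<le> ennreal \<epsilon>'" by (simp add: \<epsilon>_def)
    qed
  qed
  then obtain s where s: "strict_mono (s :: nat \<Rightarrow> nat)"
    and Cauchy: "\<And>\<epsilon>::real. 0 < \<epsilon> \<Longrightarrow> \<exists>N. \<forall>i\<ge>N. \<forall>j\<ge>N. Lp_gap p M (u (r (s i))) (u (r (s j))) \<le> ennreal \<epsilon>"
    by blast
  obtain v where "v \<in> Lp p M" "(\<lambda>k. Lp_dist p M (u (r (s k))) v) \<longlonglongrightarrow> 0"
    using Lp_complete[OF p u Cauchy] by blast
  with s show "\<exists>s v. strict_mono s \<and> v \<in> Lp p M \<and> (\<lambda>k. Lp_dist p M (u (r (s k))) v) \<longlonglongrightarrow> 0"
    by blast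
qed

section \<open>Approximation by constants on small cubes\<close>

lemma ex_le_nn_average:
  assumes h: "h \<in> borel_measurable M" and pos: "0 < emeasure M (space M)" and fin: "emeasure M (space M) < \<infinity>"
  shows "\<exists>x\<in>space M. emeasure M (space M) * h x \<le> (\<integral>\<^sup>+x. h x \<partial>M)"
proof (rule ccontr)
  let ?I = "\<integral>\<^sup>+x. h x \<partial>M"
  assume "\<not> ?thesis"
  then have less: "?I < emeasure M (space M) * h x" if "x \<in> space M" for x
    using that by (simp add: not_le)
  obtain x where "x \<in> space M" using pos by fastforce
  then have "?I < \<infinity>" using less[of x] less_le_trans[OF _ top_greatest] by auto
  have "(\<integral>\<^sup>+x. ?I \<partial>M) < (\<integral>\<^sup>+x. emeasure M (space M) * h x \<partial>M)"
  proof (rule nn_integral_less)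
    show "(\<integral>\<^sup>+x. ?I \<partial>M) \<noteq> \<infinity>"
      using \<open>?I < \<infinity>\<close> fin by (auto simp: ennreal_mult_eq_top_iff)
    show "AE x in M. ?I \<le> emeasure M (space M) * h x"
      using less by (auto intro: less_imp_le)
    show "\<not> (AE x in M. emeasure M (space M) * h x \<le> ?I)"
    proof
      assume "AE x in M. emeasure M (space M) * h x \<le> ?I"
      then have "AE x in M. False" using AE_space by eventually_elim (use less in \<open>auto simp: not_le[symmetric]\<close>)
      then show False using pos by (simp add: AE_iff_measurable[OF sets.top])
    qed
  qed (use h in measurable)
  then show False using h by (simp add: nn_integral_cmult) (simp add: mult.commute)
qed

text \<open>
  The average of \<open>\<integral> \<bar>u x - u y\<bar> powr p dx\<close> over \<open>y \<in> Q\<close> is the double integral divided by the volume of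
  \<open>Q\<close>, so for some \<open>y\<close> the integral is at most this average; take \<open>c = u y\<close>. Tonelli's theorem is applied to a Borel representative \<open>g\<close> of \<open>u\<close>, because
  Lebesgue measure on a product is only the completion of a product measure.
\<close>

lemma ex_constant_approximation:
  fixes u :: "'a::euclidean_space \<Rightarrow> real"
  assumes Q: "Q \<in> sets borel" "0 < emeasure lborel Q" "emeasure lborel Q < \<infinity>"
    and u: "u \<in> borel_measurable (lebesgue_on Q)"
  shows "\<exists>c. emeasure lborel Q * (\<integral>\<^sup>+x. ennreal (\<bar>u x - c\<bar> powr p) \<partial>lebesgue_on Q)
    \<le> (\<integral>\<^sup>+(x, y). ennreal (\<bar>u x - u y\<bar> powr p) \<partial>lebesgue_on (Q \<times> Q))"
proof -
  have "(\<lambda>x. indicator Q x *\<^sub>R u x) \<in> borel_measurable lebesgue"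
    using u Q(1) by (subst (asm) borel_measurable_restrict_space_iff) auto
  then obtain g where g [measurable]: "g \<in> borel_measurable lborel"
    and ae: "AE x in lborel. indicator Q x *\<^sub>R u x = g x"
    using completion_ex_borel_measurable_real by blast
  have aeQ: "AE x in lebesgue_on Q. u x = g x"
    using AE_completion[OF ae] Q(1) by (auto simp: AE_restrict_space_iff elim!: eventually_mono)
  have QQ: "Q \<times> Q \<in> sets borel" using Q(1) by (rule borel_Times) (rule Q(1))
  note [measurable] = Q(1)
  let ?M = "restrict_space lborel Q"
  let ?h = "\<lambda>c. \<integral>\<^sup>+x. ennreal (\<bar>g x - c\<bar> powr p) * indicator Q x \<partial>lborel"
  have h: "(\<integral>\<^sup>+x. ennreal (\<bar>u x - c\<bar> powr p) \<partial>lebesgue_on Q) = ?h c" for c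
  proof -
    have "(\<integral>\<^sup>+x. ennreal (\<bar>u x - c\<bar> powr p) \<partial>lebesgue_on Q)
        = (\<integral>\<^sup>+x. ennreal (\<bar>g x - c\<bar> powr p) \<partial>lebesgue_on Q)"
      using aeQ by (intro nn_integral_cong_AE) (auto elim!: eventually_mono)
    then show ?thesis using Q(1) by (simp add: nn_integral_restrict_space nn_integral_completion)
  qed
  have "(\<integral>\<^sup>+(x, y). ennreal (\<bar>u x - u y\<bar> powr p) \<partial>lebesgue_on (Q \<times> Q))
      = (\<integral>\<^sup>+(x, y). ennreal (\<bar>g x - g y\<bar> powr p) \<partial>lebesgue_on (Q \<times> Q))"
    by (rule nn_integral_cong_AE, rule eventually_mono[OF AE_lebesgue_on_Times[OF Q(1) aeQ]]) auto
  also have "\<dots> = (\<integral>\<^sup>+z. (\<lambda>(x, y). ennreal (\<bar>g x - g y\<bar> powr p) * indicator Q x * indicator Q y) z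
      \<partial>(lborel \<Otimes>\<^sub>M lborel))"
    using QQ by (simp add: nn_integral_restrict_space nn_integral_completion lborel_prod split_beta
        indicator_times mult.assoc)
  also have "\<dots> = (\<integral>\<^sup>+y. \<integral>\<^sup>+x. ennreal (\<bar>g x - g y\<bar> powr p) * indicator Q x * indicator Q y \<partial>lborel \<partial>lborel)"
    by (subst lborel_pair.nn_integral_snd[symmetric]) (auto simp: split_beta)
  also have "\<dots> = (\<integral>\<^sup>+y. ?h (g y) * indicator Q y \<partial>lborel)"
    by (simp add: nn_integral_multc)
  also have "\<dots> = (\<integral>\<^sup>+y. ?h (g y) \<partial>?M)"
    using Q(1) by (simp add: nn_integral_restrict_space)
  finally have I: "(\<integral>\<^sup>+(x, y). ennreal (\<bar>u x - u y\<bar> powr p) \<partial>lebesgue_on (Q \<times> Q)) = (\<integral>\<^sup>+y. ?h (g y) \<partial>?M)" .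
  have M: "emeasure ?M (space ?M) = emeasure lborel Q"
    using Q(1) by (simp add: space_restrict_space emeasure_restrict_space)
  have "(\<lambda>y. ?h (g y)) \<in> borel_measurable ?M"
    by (intro measurable_restrict_space1) measurable
  from ex_le_nn_average[OF this] show ?thesis
    using Q(2,3) unfolding M I h by blast
qed

text \<open>
  The cubes are half-open, so that for fixed \<open>h\<close> they partition the space and a pair of points lies in
  \<open>Q \<times> Q\<close> for at most one of them.
\<close>

definition grid_cube :: "real \<Rightarrow> ('n \<Rightarrow> int) \<Rightarrow> (real ^ 'n) set" where
  "grid_cube h m = {x. \<forall>i. of_int (m i) * h \<le> x $ i \<and> x $ i < (of_int (m i) + 1) * h}"

lemma grid_cube_iff_floor:
  assumes "0 < h"
  shows "x \<in> grid_cube h m \<longleftrightarrow> m = (\<lambda>i. \<lfloor>x $ i / h\<rfloor>)"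
proof -
  have "(of_int k * h \<le> t \<and> t < (of_int k + 1) * h) \<longleftrightarrow> k = \<lfloor>t / h\<rfloor>" for k t
    using assms by (auto simp: field_simps floor_eq_iff eq_commute[of k])
  then show ?thesis by (auto simp: grid_cube_def fun_eq_iff)
qed

lemma grid_cube_borel: "grid_cube h m \<in> sets borel"
proof -
  have "grid_cube h m = (\<Inter>i. {x. of_int (m i) * h \<le> x $ i} \<inter> {x. x $ i < (of_int (m i) + 1) * h})"
    by (auto simp: grid_cube_def)
  also have "\<dots> \<in> sets borel"
    by (intro sets.finite_INT sets.Int borel_closed borel_open closed_Collect_le open_Collect_less continuous_intros) auto
  finally show ?thesis .
qed

lemma grid_cube_diameter:
  fixes x y :: "real ^ 'n" and h :: real
  assumes "x \<in> grid_cube h m" "y \<in> grid_cube h m"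
  shows "norm (x - y) < CARD('n) * h"
proof -
  have "\<bar>(x - y) $ i\<bar> < h" for i
    using assms by (auto simp: grid_cube_def abs_less_iff algebra_simps) (smt (verit))+
  then have "(\<Sum>i\<in>UNIV. \<bar>(x - y) $ i\<bar>) < (\<Sum>i\<in>(UNIV :: 'n set). h)"
    by (intro sum_strict_mono) auto
  then show ?thesis using norm_le_l1_cart[of "x - y"] by simp
qed

lemma emeasure_grid_cube:
  fixes m :: "'n::finite \<Rightarrow> int"
  assumes h: "0 < h"
  shows "emeasure lborel (grid_cube h m) = ennreal (h ^ CARD('n))"
proof (rule antisym)
  define a b :: "real ^ 'n" where "a = (\<chi> i. of_int (m i) * h)" and "b = (\<chi> i. (of_int (m i) + 1) * h)"
  have "b - a = (\<chi> i. h)" by (simp add: a_def b_def vec_eq_iff algebra_simps)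
  then have edge: "(b - a) \<bullet> e = h" if "e \<in> Basis" for e
    using that by (auto simp: Basis_vec_def inner_axis)
  have ab: "a \<bullet> e \<le> b \<bullet> e" if "e \<in> Basis" for e
    using edge[OF that] h by (simp add: inner_diff_left)
  have vol: "(\<Prod>e\<in>Basis. (b - a) \<bullet> e) = h ^ CARD('n)"
    by (simp add: edge)
  have "grid_cube h m \<subseteq> cbox a b"
    by (auto simp: grid_cube_def mem_box_cart a_def b_def less_imp_le)
  then have "emeasure lborel (grid_cube h m) \<le> emeasure lborel (cbox a b)"
    by (intro emeasure_mono) auto
  also have "\<dots> = ennreal (h ^ CARD('n))"
    by (subst emeasure_lborel_cbox) (simp_all only: ab vol)
  finally show "emeasure lborel (grid_cube h m) \<le> ennreal (h ^ CARD('n))" .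
  have "box a b \<subseteq> grid_cube h m"
    by (auto simp: grid_cube_def mem_box_cart a_def b_def less_imp_le)
  then have "emeasure lborel (box a b) \<le> emeasure lborel (grid_cube h m)"
    by (intro emeasure_mono) (auto simp: grid_cube_borel)
  also have "emeasure lborel (box a b) = ennreal (h ^ CARD('n))"
    by (subst emeasure_lborel_box) (simp_all only: ab vol)
  finally show "ennreal (h ^ CARD('n)) \<le> emeasure lborel (grid_cube h m)" .
qed

lemma finite_grid_cubes_meeting_bounded:
  fixes E :: "(real ^ 'n) set"
  assumes "bounded E" "0 < h"
  shows "finite {m. grid_cube h m \<inter> E \<noteq> {}}"
proof -
  obtain R where R: "\<And>x. x \<in> E \<Longrightarrow> norm x \<le> R" using assms(1) by (auto simp: bounded_iff)
  have "m i \<in> {\<lfloor>- R / h\<rfloor>..\<lfloor>R / h\<rfloor>}" if meet: "grid_cube h m \<inter> E \<noteq> {}" for m :: "'n \<Rightarrow> int" and i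
  proof -
    obtain x where x: "x \<in> grid_cube h m" "x \<in> E" using meet by blast
    have "\<bar>x $ i\<bar> \<le> R" using component_le_norm_cart[of x i] R[OF x(2)] by simp
    then have "- R / h \<le> x $ i / h" "x $ i / h \<le> R / h"
      using assms(2) by (auto simp: field_simps abs_le_iff)
    then show ?thesis
      using x(1) assms(2) by (auto simp: grid_cube_iff_floor intro: floor_mono)
  qed
  then have "{m. grid_cube h m \<inter> E \<noteq> {}} \<subseteq>
      {f. \<forall>i. (i \<in> UNIV \<longrightarrow> f i \<in> {\<lfloor>- R / h\<rfloor>..\<lfloor>R / h\<rfloor>}) \<and> (i \<notin> UNIV \<longrightarrow> f i = 0)}"
    by auto
  then show ?thesis
    by (rule finite_subset) (intro finite_set_of_finite_funs finite_class.finite_UNIV finite_atLeastAtMost_int)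
qed

lemma nn_integral_lebesgue_on_subset:
  assumes "S \<in> sets lebesgue" "T \<in> sets lebesgue" "S \<subseteq> T"
  shows "(\<integral>\<^sup>+x. f x \<partial>lebesgue_on S) = (\<integral>\<^sup>+x. f x * indicator S x \<partial>lebesgue_on T)"
  using assms by (auto simp: nn_integral_restrict_space intro!: nn_integral_cong split: split_indicator)

text \<open>
  The side \<open>\<delta> / CARD('n)\<close> keeps points of the same cube \<open>Q\<close> at distance less than \<open>\<delta>\<close>, so on \<open>Q \<times> Q\<close> the kernel is
  at least \<open>1 / (\<epsilon> * \<delta> ^ CARD('n))\<close>. Up to the factor \<open>\<epsilon> * CARD('n) ^ CARD('n)\<close> this is the reciprocal
  of the volume of \<open>Q\<close>, the factor in front of the double integral that bounds the distance of \<open>u\<close>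
  to a constant on \<open>Q\<close>. The sets \<open>Q \<times> Q\<close> are disjoint, so the contributions add up to at most the
  energy.
\<close>

lemma step_approximation_by_energy:
  fixes u :: "real ^ 'n \<Rightarrow> real" and \<epsilon> \<delta> :: real
  assumes A: "A \<in> sets borel" and u: "u \<in> borel_measurable (lebesgue_on A)"
    and K: "K \<in> borel_measurable (lebesgue_on (A \<times> A))"
    and I: "finite I" and sub: "\<And>m. m \<in> I \<Longrightarrow> grid_cube (\<delta> / CARD('n)) m \<subseteq> A"
    and \<epsilon>: "0 < \<epsilon>" and \<delta>: "0 < \<delta>"
    and low: "AE (x, y) in lebesgue_on (A \<times> A). norm (x - y) < \<delta> \<longrightarrow>
      ennreal (1 / (\<epsilon> * \<delta> ^ CARD('n))) \<le> K (x, y)"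
  shows "\<exists>c. (\<Sum>m\<in>I. \<integral>\<^sup>+x. ennreal (\<bar>u x - c m\<bar> powr p) \<partial>lebesgue_on (grid_cube (\<delta> / CARD('n)) m))
    \<le> ennreal (\<epsilon> * CARD('n) ^ CARD('n)) * energy p A K u"
proof -
  define N where "N = CARD('n)"
  have N: "0 < N" by (simp add: N_def)
  define h where "h = \<delta> / N"
  have h: "0 < h" using \<delta> N by (simp add: h_def)
  let ?Q = "grid_cube h :: _ \<Rightarrow> (real ^ 'n) set"
  let ?F = "\<lambda>(x, y). ennreal (\<bar>u x - u y\<bar> powr p)"
  let ?\<kappa> = "ennreal (1 / (\<epsilon> * \<delta> ^ N))"
  have sub: "?Q m \<subseteq> A" if "m \<in> I" for m using sub[OF that] by (simp add: h_def N_def)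
  have vol: "emeasure lborel (?Q m) = ennreal (h ^ N)" for m
    using emeasure_grid_cube[OF h] by (simp add: N_def)
  have hN: "0 < h ^ N" using h by simp
  have QQ: "?Q m \<times> ?Q m \<in> sets borel" for m by (intro borel_Times grid_cube_borel)
  have AA: "A \<times> A \<in> sets borel" using A by (intro borel_Times)
  have "\<exists>c. emeasure lborel (?Q m) * (\<integral>\<^sup>+x. ennreal (\<bar>u x - c\<bar> powr p) \<partial>lebesgue_on (?Q m))
      \<le> integral\<^sup>N (lebesgue_on (?Q m \<times> ?Q m)) ?F" if "m \<in> I" for m
  proof (rule ex_constant_approximation)
    show "u \<in> borel_measurable (lebesgue_on (?Q m))"
      by (rule measurable_restrict_mono[OF u sub[OF that]])
  qed (use hN in \<open>simp_all add: grid_cube_borel vol\<close>)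
  then obtain c where c: "\<And>m. m \<in> I \<Longrightarrow>
      ennreal (h ^ N) * (\<integral>\<^sup>+x. ennreal (\<bar>u x - c m\<bar> powr p) \<partial>lebesgue_on (?Q m))
      \<le> integral\<^sup>N (lebesgue_on (?Q m \<times> ?Q m)) ?F"
    unfolding vol by metis
  have F: "?F \<in> borel_measurable (lebesgue_on (A \<times> A))"
    using energy_integrand_measurable[OF u, of "\<lambda>_. 1" p] by (simp add: split_beta)
  have ind: "indicator (?Q m \<times> ?Q m) \<in> borel_measurable (lebesgue_on (A \<times> A))" for m
    using QQ[of m] by (intro measurable_restrict_space1 borel_measurable_indicator) simp
  have Find: "(\<lambda>z. ?F z * indicator (?Q m \<times> ?Q m) z) \<in> borel_measurable (lebesgue_on (A \<times> A))" for m
    by (intro borel_measurable_times_ennreal F ind)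
  have const: "1 = ennreal (\<epsilon> * N ^ N) * (?\<kappa> * ennreal (h ^ N))"
    using \<epsilon> \<delta> N hN by (simp flip: ennreal_mult add: h_def power_divide)
  have "(\<Sum>m\<in>I. \<integral>\<^sup>+x. ennreal (\<bar>u x - c m\<bar> powr p) \<partial>lebesgue_on (?Q m))
      = ennreal (\<epsilon> * N ^ N) * (\<Sum>m\<in>I. ?\<kappa> * (ennreal (h ^ N) *
          (\<integral>\<^sup>+x. ennreal (\<bar>u x - c m\<bar> powr p) \<partial>lebesgue_on (?Q m))))"
    unfolding sum_distrib_left mult.assoc[symmetric] by (simp only: const[symmetric, unfolded mult.assoc[symmetric]] mult_1)
  also have "\<dots> \<le> ennreal (\<epsilon> * N ^ N) * (\<Sum>m\<in>I. ?\<kappa> * integral\<^sup>N (lebesgue_on (?Q m \<times> ?Q m)) ?F)"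
    by (intro mult_left_mono sum_mono c) auto
  also have "(\<Sum>m\<in>I. ?\<kappa> * integral\<^sup>N (lebesgue_on (?Q m \<times> ?Q m)) ?F)
      = (\<Sum>m\<in>I. \<integral>\<^sup>+z. ?\<kappa> * (?F z * indicator (?Q m \<times> ?Q m) z) \<partial>lebesgue_on (A \<times> A))"
  proof (rule sum.cong[OF refl])
    fix m assume m: "m \<in> I"
    have "integral\<^sup>N (lebesgue_on (?Q m \<times> ?Q m)) ?F = (\<integral>\<^sup>+z. ?F z * indicator (?Q m \<times> ?Q m) z \<partial>lebesgue_on (A \<times> A))"
      using sub[OF m] QQ[of m] AA by (intro nn_integral_lebesgue_on_subset) auto
    then show "?\<kappa> * integral\<^sup>N (lebesgue_on (?Q m \<times> ?Q m)) ?F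
        = (\<integral>\<^sup>+z. ?\<kappa> * (?F z * indicator (?Q m \<times> ?Q m) z) \<partial>lebesgue_on (A \<times> A))"
      by (simp only: nn_integral_cmult[OF Find])
  qed
  also have "\<dots> = (\<integral>\<^sup>+z. (\<Sum>m\<in>I. ?\<kappa> * (?F z * indicator (?Q m \<times> ?Q m) z)) \<partial>lebesgue_on (A \<times> A))"
    by (rule nn_integral_sum[symmetric]) (rule borel_measurable_times_ennreal[OF _ Find], simp)
  also have "\<dots> \<le> energy p A K u"
    unfolding energy_def
  proof (rule nn_integral_mono_AE)
    show "AE z in lebesgue_on (A \<times> A). (\<Sum>m\<in>I. ?\<kappa> * (?F z * indicator (?Q m \<times> ?Q m) z))
        \<le> (\<lambda>(x, y). ennreal (\<bar>u x - u y\<bar> powr p) * K (x, y)) z"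
      using low
    proof eventually_elim
      case (elim z)
      obtain x y where z: "z = (x, y)" by (cases z)
      \<comment> \<open>Only the cube containing \<open>x\<close> can contribute at \<open>(x, y)\<close>.\<close>
      define m0 where "m0 = (\<lambda>i. \<lfloor>x $ i / h\<rfloor>)"
      have "(\<Sum>m\<in>I. ?\<kappa> * (?F z * indicator (?Q m \<times> ?Q m) z))
          = (\<Sum>m\<in>I. if m = m0 then ?\<kappa> * (?F z * indicator (?Q m0 \<times> ?Q m0) z) else 0)"
        by (intro sum.cong) (auto simp: z m0_def grid_cube_iff_floor[OF h] split: split_indicator)
      also have "\<dots> \<le> ?\<kappa> * (?F z * indicator (?Q m0 \<times> ?Q m0) z)"
        using I by simp
      also have "\<dots> \<le> ?F z * K z"
      proof (cases "z \<in> ?Q m0 \<times> ?Q m0")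
        case True
        then have "norm (x - y) < \<delta>"
          using grid_cube_diameter[of x h m0 y] N by (simp add: z h_def N_def)
        then have "?\<kappa> * ?F z \<le> K z * ?F z"
          using elim by (intro mult_right_mono) (simp_all add: z N_def)
        then show ?thesis using True by (simp add: mult.commute[of _ "K z"])
      qed simp
      finally show ?case by (simp add: z)
    qed
  qed
  finally show ?thesis by (auto simp: h_def N_def mult_left_mono)
qed

text \<open>
  The radius \<open>\<delta>\<close> of the hypothesis need not be small compared with the distance of \<open>E\<close> to the
  complement of \<open>A\<close>. With \<open>d \<le> 1\<close> below that distance, applying the hypothesis to \<open>\<epsilon> * d ^ CARD('n)\<close>
  yields the bound for \<open>\<epsilon>\<close> at the radius \<open>d * \<delta>\<close>, which is at most \<open>d\<close> because \<open>\<delta> \<le> 1\<close>.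
\<close>

lemma kernel_lower_bound_near_compact:
  fixes A :: "(real ^ 'n) set" and \<epsilon> :: real
  assumes A: "open A" and E: "compact E" "E \<subseteq> A"
    and hyp: "\<forall>\<epsilon>::real>0. \<exists>\<delta>::real. 0 < \<delta> \<and> \<delta> \<le> 1 \<and>
      (AE (x, y) in lebesgue_on (A \<times> A). norm (x - y) < \<delta> \<longrightarrow>
        ennreal (1 / (\<epsilon> * \<delta> ^ CARD('n))) \<le> K (x, y))"
    and \<epsilon>: "0 < \<epsilon>"
  shows "\<exists>\<delta>::real>0. (\<Union>x\<in>E. ball x \<delta>) \<subseteq> A \<and>
      (AE (x, y) in lebesgue_on (A \<times> A). norm (x - y) < \<delta> \<longrightarrow>
        ennreal (1 / (\<epsilon> * \<delta> ^ CARD('n))) \<le> K (x, y))"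
proof -
  obtain d0 where d0: "0 < d0" "(\<Union>x\<in>E. ball x d0) \<subseteq> A"
    using compact_subset_open_imp_ball_epsilon_subset[OF E(1) A E(2)] .
  define d where "d = min 1 d0"
  have d: "0 < d" "d \<le> 1" "d \<le> d0" using d0 by (auto simp: d_def)
  obtain \<delta> where \<delta>: "0 < \<delta>" "\<delta> \<le> 1"
    and low: "AE (x, y) in lebesgue_on (A \<times> A). norm (x - y) < \<delta> \<longrightarrow>
        ennreal (1 / (\<epsilon> * d ^ CARD('n) * \<delta> ^ CARD('n))) \<le> K (x, y)"
  proof -
    have "0 < \<epsilon> * d ^ CARD('n)" using \<epsilon> d(1) by simp
    from hyp[rule_format, OF this] show thesis by (elim exE conjE) (rule that)
  qed
  have le: "d * \<delta> \<le> \<delta>" "d * \<delta> \<le> d0"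
    using mult_right_mono[OF d(2), of \<delta>] mult_left_mono[OF \<delta>(2), of d] d \<delta> by linarith+
  show ?thesis
  proof (intro exI[of _ "d * \<delta>"] conjI)
    show "0 < d * \<delta>" using d \<delta> by simp
    show "(\<Union>x\<in>E. ball x (d * \<delta>)) \<subseteq> A"
      using d0(2) le(2) by fastforce
    show "AE (x, y) in lebesgue_on (A \<times> A). norm (x - y) < d * \<delta> \<longrightarrow>
        ennreal (1 / (\<epsilon> * (d * \<delta>) ^ CARD('n))) \<le> K (x, y)"
      using low by eventually_elim (use le(1) in \<open>auto simp: power_mult_distrib mult.assoc\<close>)
  qed
qed

lemma Lp_restrict_subset:
  assumes u: "u \<in> Lp p (lebesgue_on A)" and "E \<subseteq> A" "E \<in> sets lebesgue" "A \<in> sets lebesgue"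
  shows "u \<in> Lp p (lebesgue_on E)" and "Lp_gap p (lebesgue_on E) u (\<lambda>_. 0) \<le> Lp_gap p (lebesgue_on A) u (\<lambda>_. 0)"
proof -
  have "u \<in> borel_measurable (lebesgue_on E)"
    using u assms(2) by (auto simp: Lp_def intro: measurable_restrict_mono)
  moreover show le: "Lp_gap p (lebesgue_on E) u (\<lambda>_. 0) \<le> Lp_gap p (lebesgue_on A) u (\<lambda>_. 0)"
    unfolding Lp_gap_def nn_integral_lebesgue_on_subset[OF assms(3,4,2)]
    by (intro nn_integral_mono) (auto split: split_indicator)
  ultimately show "u \<in> Lp p (lebesgue_on E)"
    using u by (auto simp: Lp_iff_gap_finite intro: le_less_trans)
qed

section \<open>Compactness, convergence and Gamma-convergence\<close>

text \<open>
  The cubes that meet \<open>E\<close> are finitely many, lie in \<open>A\<close> and do not depend on \<open>k\<close>. On them every \<open>u k\<close> is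
  close to a step function with bounded values, so total boundedness applies.
\<close>

lemma compact_seq_of_bounded_energy:
  fixes A :: "(real ^ 'n) set"
  assumes p: "1 \<le> p" and A: "open A" and Jk: "\<And>k. Jk k \<in> borel_measurable (lebesgue_on (A \<times> A))"
    and hyp: "\<forall>\<epsilon>::real>0. \<exists>\<delta>::real. 0 < \<delta> \<and> \<delta> \<le> 1 \<and>
      (AE (x, y) in lebesgue_on (A \<times> A). norm (x - y) < \<delta> \<longrightarrow>
        ennreal (1 / (\<epsilon> * \<delta> ^ CARD('n))) \<le> (INF k. Jk k (x, y)))"
    and u: "\<And>k. u k \<in> Lp p (lebesgue_on A)"
    and bound: "(SUP k. ennreal (Lp_norm p (lebesgue_on A) (u k)) + energy p A (Jk k) (u k)) < \<infinity>"
    and E: "compact E" "E \<subseteq> A"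
  shows "Lp_compact_seq p (lebesgue_on E) u"
proof -
  obtain B where B: "0 \<le> B" "(SUP k. ennreal (Lp_norm p (lebesgue_on A) (u k)) + energy p A (Jk k) (u k)) = ennreal B"
    using bound by (cases rule: ennreal_cases) auto
  have SB: "ennreal (Lp_norm p (lebesgue_on A) (u k)) + energy p A (Jk k) (u k) \<le> ennreal B" for k
    unfolding B(2)[symmetric] by (rule SUP_upper) simp
  have norm: "Lp_norm p (lebesgue_on A) (u k) \<le> B" for k
  proof -
    have "ennreal (Lp_norm p (lebesgue_on A) (u k)) \<le> ennreal B"
      using SB[of k] by (rule order_trans[rotated]) simp
    then show ?thesis using B(1) by simp
  qed
  have energy: "energy p A (Jk k) (u k) \<le> ennreal B" for k
    using SB[of k] by (rule order_trans[rotated]) simp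
  have As: "A \<in> sets borel" "A \<in> sets lebesgue" and Es: "E \<in> sets lebesgue"
    using A E(1) by (auto simp: borel_compact)
  have um: "u k \<in> borel_measurable (lebesgue_on A)" for k using u by (simp add: Lp_def)
  have gap0: "Lp_gap p (lebesgue_on A) (u k) (\<lambda>_. 0) \<le> ennreal (B powr p)" for k
  proof -
    have "(\<lambda>_. 0) \<in> Lp p (lebesgue_on A)" by (simp add: Lp_def)
    then have "Lp_gap p (lebesgue_on A) (u k) (\<lambda>_. 0) = ennreal (Lp_dist p (lebesgue_on A) (u k) (\<lambda>_. 0) powr p)"
      using p by (intro Lp_gap_eq_Lp_dist u) auto
    also have "\<dots> \<le> ennreal (B powr p)"
      using norm[of k] p by (intro ennreal_leI powr_mono2) (auto simp: Lp_dist_def Lp_norm_def)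
    finally show ?thesis .
  qed
  show ?thesis
  proof (rule Lp_compact_seq_of_step_approximation[OF p])
    show "u k \<in> Lp p (lebesgue_on E)" for k
      using Lp_restrict_subset(1)[OF u E(2) Es As(2)] .
    fix \<epsilon> :: real assume \<epsilon>: "0 < \<epsilon>"
    define N where "N = CARD('n)"
    have N: "0 < N" by (simp add: N_def)
    \<comment> \<open>With energies at most \<open>B\<close>, the approximation error is at most \<open>\<epsilon>1 * N ^ N * B\<close>.\<close>
    define \<epsilon>1 where "\<epsilon>1 = \<epsilon> / (N ^ N * (B + 1))"
    have \<epsilon>1: "0 < \<epsilon>1" using \<epsilon> N B by (simp add: \<epsilon>1_def)
    obtain \<delta> where \<delta>: "0 < \<delta>" and ball: "(\<Union>x\<in>E. ball x \<delta>) \<subseteq> A"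
      and low: "AE (x, y) in lebesgue_on (A \<times> A). norm (x - y) < \<delta> \<longrightarrow>
        ennreal (1 / (\<epsilon>1 * \<delta> ^ CARD('n))) \<le> (INF k. Jk k (x, y))"
      using kernel_lower_bound_near_compact[OF A E, of "\<lambda>z. INF k. Jk k z", OF hyp \<epsilon>1] by blast
    define h where "h = \<delta> / N"
    have h: "0 < h" using \<delta> N by (simp add: h_def)
    define I where "I = {m :: 'n \<Rightarrow> int. grid_cube h m \<inter> E \<noteq> {}}"
    let ?Q = "grid_cube h :: _ \<Rightarrow> (real ^ 'n) set"
    have I: "finite I"
      unfolding I_def using E(1) h by (intro finite_grid_cubes_meeting_bounded compact_imp_bounded)
    have sub: "?Q m \<subseteq> A" if "m \<in> I" for m
    proof
      fix y assume y: "y \<in> ?Q m"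
      obtain x where x: "x \<in> E" "x \<in> ?Q m" using \<open>m \<in> I\<close> by (auto simp: I_def)
      have "norm (x - y) < \<delta>" using grid_cube_diameter[OF x(2) y] N by (simp add: h_def N_def)
      then have "y \<in> ball x \<delta>" by (simp add: dist_norm)
      then show "y \<in> A" using ball x(1) by blast
    qed
    have Qs: "?Q m \<in> sets lebesgue" for m using grid_cube_borel[of h m] by simp
    have vol: "emeasure lborel (?Q m) = ennreal (h ^ N)" for m
      using emeasure_grid_cube[OF h] by (simp add: N_def)
    define R where "R = (2 powr p * (\<epsilon> + B powr p) / h ^ N) powr (1 / p)"
    have approx: "\<exists>c. (\<forall>m\<in>I. \<bar>c m\<bar> \<le> R) \<and>
        (\<Sum>m\<in>I. \<integral>\<^sup>+x\<in>?Q m \<inter> E. ennreal (\<bar>u k x - c m\<bar> powr p) \<partial>lebesgue_on E) \<le> ennreal \<epsilon>" for k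
    proof -
      have lowk: "AE (x, y) in lebesgue_on (A \<times> A). norm (x - y) < \<delta> \<longrightarrow>
          ennreal (1 / (\<epsilon>1 * \<delta> ^ CARD('n))) \<le> Jk k (x, y)"
        using low by eventually_elim (auto intro: order_trans[OF _ INF_lower])
      obtain c where c: "(\<Sum>m\<in>I. \<integral>\<^sup>+x. ennreal (\<bar>u k x - c m\<bar> powr p) \<partial>lebesgue_on (?Q m))
          \<le> ennreal (\<epsilon>1 * N ^ N) * energy p A (Jk k) (u k)"
        using step_approximation_by_energy[OF As(1) um Jk I _ \<epsilon>1 \<delta> lowk, of k p] sub
        by (auto simp: h_def N_def)
      note c
      also have "ennreal (\<epsilon>1 * N ^ N) * energy p A (Jk k) (u k) \<le> ennreal (\<epsilon>1 * N ^ N) * ennreal B"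
        by (intro mult_left_mono energy) simp
      also have "\<dots> \<le> ennreal \<epsilon>"
      proof -
        have "\<epsilon>1 * N ^ N * B = \<epsilon> * (B / (B + 1))" using N by (simp add: \<epsilon>1_def)
        also have "\<dots> \<le> \<epsilon>" using \<epsilon> B(1) by (intro mult_left_le) auto
        finally show ?thesis using \<epsilon>1 B(1) by (simp flip: ennreal_mult add: ennreal_leI)
      qed
      finally have sum: "(\<Sum>m\<in>I. Lp_gap p (lebesgue_on (?Q m)) (u k) (\<lambda>_. c m)) \<le> ennreal \<epsilon>"
        by (simp add: Lp_gap_def)
      show ?thesis
      proof (intro exI[of _ c] conjI ballI)
        fix m assume m: "m \<in> I"
        show "\<bar>c m\<bar> \<le> R"
          unfolding R_def
        proof (rule constant_bound_of_gap[OF p])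
          show "u k \<in> borel_measurable (lebesgue_on (?Q m))"
            by (rule measurable_restrict_mono[OF um sub[OF m]])
          show "emeasure (lebesgue_on (?Q m)) (space (lebesgue_on (?Q m))) = ennreal (h ^ N)"
            using Qs[of m] grid_cube_borel[of h m] by (simp add: space_restrict_space emeasure_restrict_space vol)
          show "Lp_gap p (lebesgue_on (?Q m)) (u k) (\<lambda>_. c m) \<le> ennreal \<epsilon>"
            using sum member_le_sum[OF m, of "\<lambda>m. Lp_gap p (lebesgue_on (?Q m)) (u k) (\<lambda>_. c m)"] I
            by (auto intro: order_trans)
          show "Lp_gap p (lebesgue_on (?Q m)) (u k) (\<lambda>_. 0) \<le> ennreal (B powr p)"
            using Lp_restrict_subset(2)[OF u sub[OF m] Qs As(2)] gap0 by (rule order_trans)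
        qed (use h \<epsilon> in auto)
      next
        have "(\<integral>\<^sup>+x\<in>?Q m \<inter> E. ennreal (\<bar>u k x - c m\<bar> powr p) \<partial>lebesgue_on E)
            \<le> Lp_gap p (lebesgue_on (?Q m)) (u k) (\<lambda>_. c m)" for m
          unfolding Lp_gap_def using Es Qs[of m]
          by (simp add: nn_integral_restrict_space) (auto intro!: nn_integral_mono split: split_indicator)
        then show "(\<Sum>m\<in>I. \<integral>\<^sup>+x\<in>?Q m \<inter> E. ennreal (\<bar>u k x - c m\<bar> powr p) \<partial>lebesgue_on E) \<le> ennreal \<epsilon>"
          by (intro order_trans[OF sum_mono sum])
      qed
    qed
    have "?Q m \<inter> E \<in> sets (lebesgue_on E) \<and> emeasure (lebesgue_on E) (?Q m \<inter> E) < \<infinity>" for m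
    proof -
      have "emeasure lebesgue (?Q m \<inter> E) \<le> emeasure lebesgue (?Q m)"
        using Qs by (intro emeasure_mono) auto
      also have "\<dots> < \<infinity>" using grid_cube_borel[of h m] by (simp add: vol)
      finally show ?thesis
        using Es Qs[of m] by (auto simp: sets_restrict_space_iff emeasure_restrict_space)
    qed
    moreover have "space (lebesgue_on E) \<subseteq> (\<Union>m\<in>I. ?Q m \<inter> E)"
    proof
      fix x assume "x \<in> space (lebesgue_on E)"
      then have "x \<in> E" by (simp add: space_restrict_space)
      moreover have "x \<in> ?Q (\<lambda>i. \<lfloor>x $ i / h\<rfloor>)" by (simp add: grid_cube_iff_floor[OF h])
      ultimately show "x \<in> (\<Union>m\<in>I. ?Q m \<inter> E)" unfolding I_def by blast
    qed
    ultimately have "finite I \<and>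
      (\<forall>i\<in>I. ?Q i \<inter> E \<in> sets (lebesgue_on E) \<and> emeasure (lebesgue_on E) (?Q i \<inter> E) < \<infinity>) \<and>
      space (lebesgue_on E) \<subseteq> (\<Union>i\<in>I. ?Q i \<inter> E) \<and>
      (\<forall>k. \<exists>c. (\<forall>i\<in>I. \<bar>c i\<bar> \<le> R) \<and>
        (\<Sum>i\<in>I. \<integral>\<^sup>+x\<in>?Q i \<inter> E. ennreal (\<bar>u k x - c i\<bar> powr p) \<partial>lebesgue_on E) \<le> ennreal \<epsilon>)"
      using I approx by (intro conjI ballI allI) simp_all
    then show "\<exists>(I :: ('n \<Rightarrow> int) set) Q R. finite I \<and>
      (\<forall>i\<in>I. Q i \<in> sets (lebesgue_on E) \<and> emeasure (lebesgue_on E) (Q i) < \<infinity>) \<and>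
      space (lebesgue_on E) \<subseteq> (\<Union>i\<in>I. Q i) \<and>
      (\<forall>k. \<exists>c. (\<forall>i\<in>I. \<bar>c i\<bar> \<le> R) \<and>
        (\<Sum>i\<in>I. \<integral>\<^sup>+x\<in>Q i. ennreal (\<bar>u k x - c i\<bar> powr p) \<partial>lebesgue_on E) \<le> ennreal \<epsilon>)"
      by (intro exI[of _ I] exI[of _ "\<lambda>m. ?Q m \<inter> E"] exI[of _ R])
  qed
qed

theorem theorem1p11:
  fixes p :: real
    and A :: "(real ^ 'n) set"
    and Jk :: "nat \<Rightarrow> (real ^ 'n) \<times> (real ^ 'n) \<Rightarrow> ennreal"
    and J :: "(real ^ 'n) \<times> (real ^ 'n) \<Rightarrow> ennreal"
  assumes "1 \<le> p" and "open A"
    and "\<And>k. Jk k \<in> borel_measurable (lebesgue_on (A \<times> A))"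
    and "J \<in> borel_measurable (lebesgue_on (A \<times> A))"
  shows
    "((\<forall>\<epsilon>::real>0. \<exists>\<delta>::real. 0 < \<delta> \<and> \<delta> \<le> 1 \<and>
         (AE (x, y) in lebesgue_on (A \<times> A). norm (x - y) < \<delta> \<longrightarrow>
            ennreal (1 / (\<epsilon> * \<delta> ^ CARD('n))) \<le> (INF k. Jk k (x, y))))
      \<longrightarrow> (\<forall>u. (\<forall>k. u k \<in> Lp p (lebesgue_on A)) \<and>
             (SUP k. ennreal (Lp_norm p (lebesgue_on A) (u k)) + energy p A (Jk k) (u k)) < \<infinity>
           \<longrightarrow> (\<forall>E. compact E \<and> E \<subseteq> A \<longrightarrow> Lp_compact_seq p (lebesgue_on E) u)))
     \<and>
     ((AE z in lebesgue_on (A \<times> A). J z \<le> liminf (\<lambda>k. Jk k z))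
      \<longrightarrow> (\<forall>u u0. (\<forall>k. u k \<in> Lp p (lebesgue_on A)) \<and> u0 \<in> Lp p (lebesgue_on A) \<and>
             (\<lambda>k. Lp_dist p (lebesgue_on A) (u k) u0) \<longlonglongrightarrow> 0
           \<longrightarrow> energy p A J u0 \<le> liminf (\<lambda>k. energy p A (Jk k) (u k))))
     \<and>
     ((AE z in lebesgue_on (A \<times> A). (\<lambda>k. Jk k z) \<longlonglongrightarrow> J z)
      \<longrightarrow> (\<forall>u. u \<in> Lp p (lebesgue_on A) \<and> energy p A J u < \<infinity> \<and>
             (dominated_kernels A Jk J \<or>
              (piecewise_monotone_kernels A Jk \<and> (\<exists>k. energy p A (Jk k) u < \<infinity>)))
           \<longrightarrow> (\<lambda>k. energy p A (Jk k) u) \<longlonglongrightarrow> energy p A J u))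
     \<and>
     ((AE z in lebesgue_on (A \<times> A). (\<lambda>k. Jk k z) \<longlonglongrightarrow> J z) \<and>
      (dominated_kernels A Jk J \<or>
       (piecewise_monotone_kernels A Jk \<and>
        (\<forall>u \<in> energy_space p A J. \<exists>k. energy p A (Jk k) u < \<infinity>)))
      \<longrightarrow> (\<forall>u \<in> energy_space p A J. (\<lambda>k. energy p A (Jk k) u) \<longlonglongrightarrow> energy p A J u) \<and>
          gamma_converges (energy_space p A J) (Lp_dist p (lebesgue_on A))
            (\<lambda>k. energy p A (Jk k)) (energy p A J))"
proof -
  have A: "A \<in> sets borel" using assms(2) by simp
  have pointwise: "(\<lambda>k. energy p A (Jk k) u) \<longlonglongrightarrow> energy p A J u"
    if "AE z in lebesgue_on (A \<times> A). (\<lambda>k. Jk k z) \<longlonglongrightarrow> J z"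
      and "dominated_kernels A Jk J \<or> (piecewise_monotone_kernels A Jk \<and>
        (\<forall>u \<in> energy_space p A J. \<exists>k. energy p A (Jk k) u < \<infinity>))"
      and "u \<in> energy_space p A J" for u
    using that by (intro energy_pointwise_convergence[OF A assms(3,4)]) (auto simp: energy_space_def Lp_def)
  show ?thesis
  proof (intro conjI impI allI, goal_cases)
    case (1 u E)
    then show ?case
      by (intro compact_seq_of_bounded_energy[OF assms(1-3)]) auto
  next
    case (2 u u0)
    then show ?case
      using assms(1) A by (intro energy_liminf[OF _ A assms(3)]) auto
  next
    case (3 u)
    then show ?case
      by (intro energy_pointwise_convergence[OF A assms(3,4)]) (auto simp: Lp_def)
  next
    case 4
    then show ?case by (blast intro: pointwise)
  next
    case 5
    show ?case
      unfolding gamma_converges_def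
    proof (intro ballI conjI allI impI, elim conjE)
      fix u us
      assume u: "u \<in> energy_space p A J" and us: "\<forall>k. us k \<in> energy_space p A J"
        and lim: "(\<lambda>k. Lp_dist p (lebesgue_on A) (us k) u) \<longlonglongrightarrow> 0"
      have "AE z in lebesgue_on (A \<times> A). J z \<le> liminf (\<lambda>k. Jk k z)"
        using conjunct1[OF 5] by eventually_elim (simp add: lim_imp_Liminf)
      then show "energy p A J u \<le> liminf (\<lambda>k. energy p A (Jk k) (us k))"
        using assms(1) u us lim by (intro energy_liminf[OF _ A assms(3)]) (auto simp: energy_space_def)
    next
      fix u assume u: "u \<in> energy_space p A J"
      \<comment> \<open>By pointwise convergence the constant sequence is a recovery sequence.\<close>
      have "limsup (\<lambda>k. energy p A (Jk k) u) = energy p A J u"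
        using pointwise[OF conjunct1[OF 5] conjunct2[OF 5] u] by (intro lim_imp_Limsup) simp_all
      moreover have "Lp_dist p (lebesgue_on A) u u = 0"
        by (simp add: Lp_dist_def Lp_norm_def)
      ultimately show "\<exists>us. (\<forall>k. us k \<in> energy_space p A J) \<and>
          (\<lambda>k. Lp_dist p (lebesgue_on A) (us k) u) \<longlonglongrightarrow> 0 \<and>
          limsup (\<lambda>k. energy p A (Jk k) (us k)) \<le> energy p A J u"
        using u by (intro exI[of _ "\<lambda>_. u"]) simp
    qed
  qed
qed

end
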